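(* Let $M$ be a nonsingular complex algebraic variety and $f:M\to\mathbb C$ a regular function such that $D=f^{-1}(0)=\bigcup_{i\in I}D_i$ is a divisor with simple normal crossings. After division by the diagonal action of $\mathbb R_{>0}$, the map $\mathrm{sign} f$ on $(M,D)^{\mathrm{cpl}}$ induces a map $$\big((M,D)^{\mathrm{cpl}}\setminus(M,D)^{\mathrm{top}}\big)/\mathbb R_{>0}\to S^1$$ that coincides with A'Campo's second model $\tilde N\to S^1$ of the topological Milnor fibration (that is, there is a homeomorphism from the quotient onto $\tilde N$ compatible with the maps to $S^1$).
   Context: **Set-up.** $D=\bigcup_{i\in I}D_i$ with $I$ finite and $D_i$ nonsingular hypersurfaces meeting transversally. For $i\in I$, $L_i\to M$ is the algebraic line bundle associated with $D_i$ (with a Hermitian metric $|\cdot|$) and $s_i$ is a regular section of $L_i$, transverse to the zero section, with zero locus $D_i$. Then $f=u\prod_{i\in I}s_i^{N_i}$ with integers $N_i\ge1$ and $u$ a nowhere vanishing regular section of $\bigotimes_iL_i^{-N_i}$. For $J\subset I$: $D_J^\circ=\bigcap_{j\in J}D_j\setminus\bigcup_{i\notin J}D_i$; for $x\in M$, $J(x)=\{i:x\in D_i\}$. For a line bundle $L$, $L^*$ is $L$ minus its zero section and $\mathbb S(L)=L^*/\mathbb R_{>0}$. **Complete space.** $\mathbb S(L_i\oplus\mathbf 1_{\ge0})$ is the fibrewise compactification of $L_i$ by a circle at infinity, with fibre $((L_{i,x}\times\mathbb R_{\ge0})\setminus\{(0,0)\})/\mathbb R_{>0}$ (diagonal action);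 $L_i$ embeds by $v\mapsto[(v,1)]$ and the part at infinity is $\mathbb S(L_i)$. Put $(M,D_i)^{\mathrm{top}}=\widehat M_i=\{(x,\theta):\theta\in\mathbb S(L_i)_x,\ \theta=s_i(x)\bmod\mathbb R_{>0}\text{ if }x\notin D_i\}$ (the real oriented blowing-up of $M$ along $D_i$), and $(M,D_i)^{\mathrm{cpl}}=\widehat M_i\sqcup L^*_{i|D_i}\subset\mathbb S(L_i\oplus\mathbf 1_{\ge0})$ with the subspace topology. $(M,D)^{\mathrm{top}}$ and $(M,D)^{\mathrm{cpl}}$ are the fibre products over $M$ of the $(M,D_i)^{\mathrm{top}}$ and of the $(M,D_i)^{\mathrm{cpl}}$, $i\in I$. Thus a point of $(M,D)^{\mathrm{cpl}}$ over $x$ consists, for $i\in J(x)$, of an element of $L^*_{i,x}\sqcup\mathbb S(L_i)_x$ (and $s_i(x)\bmod\mathbb R_{>0}$ for $i\notin J(x)$); it lies in $(M,D)^{\mathrm{top}}$ iff all components are at infinity. In particular $(M,D)^{\mathrm{cpl}}\setminus(M,D)^{\mathrm{top}}$ lies over $D$. **The map $\mathrm{sign} f$.** $\mathrm{sign} f:(M,D)^{\mathrm{cpl}}_{|D}\to S^1$ is given over $D_J^\circ$, $J\ne\varnothing$, as follows: with $u_J=u\prod_{i\notin J}s_i^{N_i}$ and $\theta_j\in\mathbb S(L_j)_x$ the direction of the $j$-th component (its class modulo $\mathbb R_{>0}$ if it is in $L^*_{j,x}$, itself if at infinity), $\mathrm{sign} f=w/|w|$ with $w=u_J(x)\prod_{j\in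 J}v_j^{N_j}\in\mathbb C^*$ for any $v_j\in L_{j,x}^*$ with direction $\theta_j$. **Diagonal action.** $\lambda\in\mathbb R_{>0}$ acts on $(M,D)^{\mathrm{cpl}}\setminus(M,D)^{\mathrm{top}}$ by multiplying every finite component $v_j\in L_{j,x}^*$ by $\lambda$ and fixing the components at infinity. **A'Campo's second model.** Let $\Delta=\{\xi\in\mathbb R^I:\xi_i\ge0,\ \sum\xi_i=1\}$ and $\tilde D=\{(x,\xi)\in D\times\Delta:\xi_i=0\text{ if }x\notin D_i\}$ (the space obtained from the normal crossing divisor $D$ by adjoining simplices). Then $\tilde N=\tilde D\times_D(M,D)^{\mathrm{top}}_{|D}$, and the map $\tilde N\to S^1$ is the composition of the projection to $(M,D)^{\mathrm{top}}_{|D}$ with $\mathrm{sign} f$ (A'Campo's first model). *)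

theory Defs
  imports "HOL-Analysis.Analysis"
begin

section \<open>Complex algebraic varieties as spaces with functions\<close>

text \<open>
  Affine \<open>n\<close>-space is the set of sequences vanishing from index \<open>n\<close> on, so that varieties with
  affine charts in different affine spaces fit in one type.
\<close>

definition affine_space :: "nat \<Rightarrow> (nat \<Rightarrow> complex) set" where
  "affine_space n = {z. \<forall>i\<ge>n. z i = 0}"

inductive_set poly_fun :: "nat \<Rightarrow> ((nat \<Rightarrow> complex) \<Rightarrow> complex) set" for n :: nat where
  const: "(\<lambda>z. c) \<in> poly_fun n"
| coord: "i < n \<Longrightarrow> (\<lambda>z. z i) \<in> poly_fun n"
| add: "p \<in> poly_fun n \<Longrightarrow> q \<in> poly_fun n \<Longrightarrow> (\<lambda>z. p z + q z) \<in> poly_fun n"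
| mult: "p \<in> poly_fun n \<Longrightarrow> q \<in> poly_fun n \<Longrightarrow> (\<lambda>z. p z * q z) \<in> poly_fun n"

definition algebraic_set :: "nat \<Rightarrow> (nat \<Rightarrow> complex) set \<Rightarrow> bool" where
  "algebraic_set n V \<longleftrightarrow>
     (\<exists>S\<subseteq>poly_fun n. V = {z \<in> affine_space n. \<forall>p\<in>S. p z = 0})"

definition zariski_open_in :: "nat \<Rightarrow> (nat \<Rightarrow> complex) set \<Rightarrow> (nat \<Rightarrow> complex) set \<Rightarrow> bool" where
  "zariski_open_in n V W \<longleftrightarrow> (\<exists>Z. algebraic_set n Z \<and> W = V - Z)"

definition regular_fun_on ::
    "nat \<Rightarrow> (nat \<Rightarrow> complex) set \<Rightarrow> ((nat \<Rightarrow> complex) \<Rightarrow> complex) \<Rightarrow> bool" where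
  "regular_fun_on n W g \<longleftrightarrow>
     (\<forall>z\<in>W. \<exists>p\<in>poly_fun n. \<exists>q\<in>poly_fun n.
        q z \<noteq> 0 \<and> (\<forall>y\<in>W. q y \<noteq> 0 \<longrightarrow> g y = p y / q y))"

text \<open>
  A space with functions: a Zariski topology and, for each open set \<open>U\<close>, the functions regular
  on \<open>U\<close>.  They are represented by total functions whose values outside \<open>U\<close> are irrelevant.
\<close>

record 'a fun_space =
  zariski :: "'a topology"
  reg :: "'a set \<Rightarrow> ('a \<Rightarrow> complex) set"

abbreviation points :: "'a fun_space \<Rightarrow> 'a set" where
  "points X \<equiv> topspace (zariski X)"

definition function_sheaf :: "'a fun_space \<Rightarrow> bool" where
  "function_sheaf X \<longleftrightarrow>
     (\<forall>U g h. openin (zariski X) U \<and> g \<in> reg X U \<and> (\<forall>x\<in>U. h x = g x) \<longrightarrow> h \<in> reg X U) \<and>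
     (\<forall>U V g. openin (zariski X) U \<and> openin (zariski X) V \<and> V \<subseteq> U \<and> g \<in> reg X U
        \<longrightarrow> g \<in> reg X V) \<and>
     (\<forall>\<U> g. (\<forall>U\<in>\<U>. openin (zariski X) U \<and> g \<in> reg X U) \<longrightarrow> g \<in> reg X (\<Union>\<U>))"

definition affine_chart ::
    "'a fun_space \<Rightarrow> 'a set \<Rightarrow> nat \<Rightarrow> ('a \<Rightarrow> nat \<Rightarrow> complex) \<Rightarrow> bool" where
  "affine_chart X U n \<phi> \<longleftrightarrow>
     openin (zariski X) U \<and> inj_on \<phi> U \<and> algebraic_set n (\<phi> ` U) \<and>
     (\<forall>W\<subseteq>U. openin (zariski X) W \<longleftrightarrow> zariski_open_in n (\<phi> ` U) (\<phi> ` W)) \<and>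
     (\<forall>W\<subseteq>U. openin (zariski X) W \<longrightarrow>
        (\<forall>g. g \<in> reg X W \<longleftrightarrow> regular_fun_on n (\<phi> ` W) (g \<circ> inv_into U \<phi>)))"

definition join :: "nat \<Rightarrow> (nat \<Rightarrow> complex) \<Rightarrow> (nat \<Rightarrow> complex) \<Rightarrow> nat \<Rightarrow> complex" where
  "join n z w = (\<lambda>i. if i < n then z i else w (i - n))"

text \<open>
  The last clause is Serre's form of separatedness: the diagonal is closed in the product of any
  two affine charts.  Varieties are not required to be irreducible.
\<close>

definition algebraic_variety :: "'a fun_space \<Rightarrow> bool" where
  "algebraic_variety X \<longleftrightarrow>
     function_sheaf X \<and>
     (\<exists>\<U>. finite \<U> \<and> (\<forall>U\<in>\<U>. \<exists>n \<phi>. affine_chart X U n \<phi>) \<and> \<Union>\<U> = points X) \<and>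
     (\<forall>U n \<phi> V m \<psi>. affine_chart X U n \<phi> \<and> affine_chart X V m \<psi> \<longrightarrow>
        algebraic_set (n + m) ((\<lambda>x. join n (\<phi> x) (\<psi> x)) ` (U \<inter> V)))"

text \<open>
  The complex (classical) topology is the coarsest one in which Zariski open sets are open and
  regular functions on them are continuous.
\<close>

definition complex_topology :: "'a fun_space \<Rightarrow> 'a topology" where
  "complex_topology X = topology_generated_by
     {{x \<in> U. g x \<in> W} | U g W. openin (zariski X) U \<and> g \<in> reg X U \<and> open W}"


section \<open>Tangent spaces, dimension, nonsingularity\<close>

definition germs_at :: "'a fun_space \<Rightarrow> 'a \<Rightarrow> ('a \<Rightarrow> complex) set" where
  "germs_at X x = {g. \<exists>U. openin (zariski X) U \<and> x \<in> U \<and> g \<in> reg X U}"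

definition near :: "'a fun_space \<Rightarrow> 'a \<Rightarrow> ('a \<Rightarrow> bool) \<Rightarrow> bool" where
  "near X x P \<longleftrightarrow> (\<exists>U. openin (zariski X) U \<and> x \<in> U \<and> (\<forall>y\<in>U. P y))"

text \<open>Tangent vectors are point derivations; the value off \<open>germs_at X x\<close> is normalised to 0.\<close>

definition tangent_space :: "'a fun_space \<Rightarrow> 'a \<Rightarrow> (('a \<Rightarrow> complex) \<Rightarrow> complex) set" where
  "tangent_space X x = {\<delta>.
     (\<forall>g. g \<notin> germs_at X x \<longrightarrow> \<delta> g = 0) \<and>
     (\<forall>g\<in>germs_at X x. \<forall>h\<in>germs_at X x. near X x (\<lambda>y. g y = h y) \<longrightarrow> \<delta> g = \<delta> h) \<and>
     (\<forall>g\<in>germs_at X x. \<forall>h\<in>germs_at X x. \<delta> (\<lambda>y. g y + h y) = \<delta> g + \<delta> h) \<and>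
     (\<forall>g\<in>germs_at X x. \<forall>c. \<delta> (\<lambda>y. c * g y) = c * \<delta> g) \<and>
     (\<forall>g\<in>germs_at X x. \<forall>h\<in>germs_at X x. \<delta> (\<lambda>y. g y * h y) = \<delta> g * h x + g x * \<delta> h)}"

definition tangent_dim :: "'a fun_space \<Rightarrow> 'a \<Rightarrow> nat \<Rightarrow> bool" where
  "tangent_dim X x d \<longleftrightarrow>
     (\<exists>b. (\<forall>k<d. b k \<in> tangent_space X x) \<and>
        (\<forall>\<delta>\<in>tangent_space X x.
           \<exists>!c :: nat \<Rightarrow> complex. (\<forall>k\<ge>d. c k = 0) \<and> \<delta> = (\<lambda>g. \<Sum>k<d. c k * b k g)))"

definition irreducible_closed :: "'a topology \<Rightarrow> 'a set \<Rightarrow> bool" where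
  "irreducible_closed T Z \<longleftrightarrow> closedin T Z \<and> Z \<noteq> {} \<and>
     (\<forall>A B. closedin T A \<and> closedin T B \<and> Z \<subseteq> A \<union> B \<longrightarrow> Z \<subseteq> A \<or> Z \<subseteq> B)"

definition has_chain_at :: "'a fun_space \<Rightarrow> 'a \<Rightarrow> nat \<Rightarrow> bool" where
  "has_chain_at X x d \<longleftrightarrow>
     (\<exists>Z. (\<forall>k\<le>d. irreducible_closed (zariski X) (Z k) \<and> x \<in> Z k) \<and>
          (\<forall>k<d. Z k \<subset> Z (Suc k)))"

text \<open>
  Irreducible closed sets through \<open>x\<close> are the primes of the local ring at \<open>x\<close>, so this is
  its Krull dimension; hence \<open>nonsingular\<close> below says that all local rings are regular.
\<close>

definition local_dim :: "'a fun_space \<Rightarrow> 'a \<Rightarrow> nat \<Rightarrow> bool" where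
  "local_dim X x d \<longleftrightarrow> has_chain_at X x d \<and> \<not> has_chain_at X x (Suc d)"

definition nonsingular :: "'a fun_space \<Rightarrow> bool" where
  "nonsingular X \<longleftrightarrow> (\<forall>x\<in>points X. \<exists>d. local_dim X x d \<and> tangent_dim X x d)"


section \<open>Hypersurfaces\<close>

text \<open>A closed subset with its reduced structure: functions locally restricted from \<open>X\<close>.\<close>

definition subvariety :: "'a fun_space \<Rightarrow> 'a set \<Rightarrow> 'a fun_space" where
  "subvariety X D =
     \<lparr> zariski = subtopology (zariski X) D,
       reg = (\<lambda>W. {g. \<forall>x\<in>W. \<exists>U h. openin (zariski X) U \<and> x \<in> U \<and> h \<in> reg X U \<and>
                       (\<forall>y\<in>U \<inter> W. g y = h y)}) \<rparr>"

definition nonsingular_hypersurface :: "'a fun_space \<Rightarrow> 'a set \<Rightarrow> bool" where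
  "nonsingular_hypersurface X D \<longleftrightarrow>
     closedin (zariski X) D \<and> nonsingular (subvariety X D) \<and>
     (\<forall>x\<in>D. \<exists>d. local_dim (subvariety X D) x d \<and> local_dim X x (Suc d))"

text \<open>The tangent space of \<open>D\<close> at \<open>x\<close>, as a subspace of that of \<open>X\<close>.\<close>

definition tangent_subspace ::
    "'a fun_space \<Rightarrow> 'a set \<Rightarrow> 'a \<Rightarrow> (('a \<Rightarrow> complex) \<Rightarrow> complex) set" where
  "tangent_subspace X D x =
     {\<delta> \<in> tangent_space X x.
        \<forall>g\<in>germs_at X x. near X x (\<lambda>y. y \<in> D \<longrightarrow> g y = 0) \<longrightarrow> \<delta> g = 0}"

definition indices_at :: "'i set \<Rightarrow> ('i \<Rightarrow> 'a set) \<Rightarrow> 'a \<Rightarrow> 'i set" where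
  "indices_at I D x = {i \<in> I. x \<in> D i}"

text \<open>
  Transversality of a family of subspaces \<open>T\<^sub>i\<close> of \<open>T\<close>: the map from \<open>T\<close> to the product of the
  quotients \<open>T / T\<^sub>i\<close> is onto.
\<close>

definition meet_transversally :: "'a fun_space \<Rightarrow> 'i set \<Rightarrow> ('i \<Rightarrow> 'a set) \<Rightarrow> bool" where
  "meet_transversally X I D \<longleftrightarrow>
     (\<forall>x\<in>points X. \<forall>\<epsilon>. (\<forall>i\<in>indices_at I D x. \<epsilon> i \<in> tangent_space X x) \<longrightarrow>
        (\<exists>\<delta>\<in>tangent_space X x. \<forall>i\<in>indices_at I D x.
           (\<lambda>g. \<delta> g - \<epsilon> i g) \<in> tangent_subspace X (D i) x))"

definition local_equation :: "'a fun_space \<Rightarrow> 'a set \<Rightarrow> 'a set \<Rightarrow> ('a \<Rightarrow> complex) \<Rightarrow> bool" where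
  "local_equation X D U h \<longleftrightarrow> h \<in> reg X U \<and>
     (\<forall>x\<in>U. \<forall>g\<in>germs_at X x.
        near X x (\<lambda>y. y \<in> D \<longrightarrow> g y = 0) \<longleftrightarrow>
        (\<exists>k\<in>germs_at X x. near X x (\<lambda>y. g y = h y * k y)))"


section \<open>Algebraic line bundles\<close>

record ('a, 'b) line_bundle =
  total :: "'b set"
  bproj :: "'b \<Rightarrow> 'a"
  vadd :: "'b \<Rightarrow> 'b \<Rightarrow> 'b"
  smul :: "complex \<Rightarrow> 'b \<Rightarrow> 'b"
  atlas :: "('a set \<times> ('b \<Rightarrow> complex)) set"

definition fibre :: "('a, 'b) line_bundle \<Rightarrow> 'a \<Rightarrow> 'b set" where
  "fibre L x = {v \<in> total L. bproj L v = x}"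

definition nonzero_part :: "('a, 'b) line_bundle \<Rightarrow> 'b set" where
  "nonzero_part L = {v \<in> total L. smul L 0 v \<noteq> v}"

text \<open>A trivialization over \<open>U\<close> is given by its fibre coordinate \<open>t\<close>.\<close>

definition local_triv ::
    "'a fun_space \<Rightarrow> ('a, 'b) line_bundle \<Rightarrow> 'a set \<Rightarrow> ('b \<Rightarrow> complex) \<Rightarrow> bool" where
  "local_triv X L U t \<longleftrightarrow>
     openin (zariski X) U \<and>
     (\<forall>x\<in>U. bij_betw t (fibre L x) UNIV \<and>
        (\<forall>v\<in>fibre L x. (\<forall>c. t (smul L c v) = c * t v) \<and>
                        (\<forall>w\<in>fibre L x. t (vadd L v w) = t v + t w))) \<and>
     (\<forall>(U', t')\<in>atlas L. \<exists>g\<in>reg X (U \<inter> U').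
        \<forall>x\<in>U \<inter> U'. g x \<noteq> 0 \<and> (\<forall>v\<in>fibre L x. t' v = g x * t v))"

definition algebraic_line_bundle :: "'a fun_space \<Rightarrow> ('a, 'b) line_bundle \<Rightarrow> bool" where
  "algebraic_line_bundle X L \<longleftrightarrow>
     bproj L ` total L \<subseteq> points X \<and>
     (\<forall>x\<in>points X. \<forall>v\<in>fibre L x. (\<forall>c. smul L c v \<in> fibre L x) \<and>
        (\<forall>w\<in>fibre L x. vadd L v w \<in> fibre L x)) \<and>
     (\<Union>(U, t)\<in>atlas L. U) = points X \<and>
     (\<forall>(U, t)\<in>atlas L. local_triv X L U t)"

definition bundle_topology :: "'a fun_space \<Rightarrow> ('a, 'b) line_bundle \<Rightarrow> 'b topology" where
  "bundle_topology X L = topology_generated_by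
     {{v \<in> total L. bproj L v \<in> A \<inter> U \<and> t v \<in> W} | A U t W.
        openin (complex_topology X) A \<and> (U, t) \<in> atlas L \<and> open W}"

definition regular_section ::
    "'a fun_space \<Rightarrow> ('a, 'b) line_bundle \<Rightarrow> 'a set \<Rightarrow> ('a \<Rightarrow> 'b) \<Rightarrow> bool" where
  "regular_section X L U s \<longleftrightarrow>
     (\<forall>x\<in>U. s x \<in> fibre L x) \<and> (\<forall>(V, t)\<in>atlas L. (\<lambda>x. t (s x)) \<in> reg X (U \<inter> V))"

definition zero_locus :: "'a fun_space \<Rightarrow> ('a, 'b) line_bundle \<Rightarrow> ('a \<Rightarrow> 'b) \<Rightarrow> 'a set" where
  "zero_locus X L s = {x \<in> points X. s x \<notin> nonzero_part L}"

text \<open>At a zero, the differential of the section read in a trivialization is onto \<open>\<complex>\<close>.\<close>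

definition transverse_to_zero_section ::
    "'a fun_space \<Rightarrow> ('a, 'b) line_bundle \<Rightarrow> ('a \<Rightarrow> 'b) \<Rightarrow> bool" where
  "transverse_to_zero_section X L s \<longleftrightarrow>
     (\<forall>x\<in>zero_locus X L s. \<forall>(U, t)\<in>atlas L. x \<in> U \<longrightarrow>
        (\<exists>\<delta>\<in>tangent_space X x. \<delta> (\<lambda>y. t (s y)) \<noteq> 0))"

text \<open>
  \<open>L\<close> is the bundle \<open>O(D)\<close>: with local equations \<open>h\<close>, \<open>h'\<close> of \<open>D\<close>, its transition functions
  are \<open>h' / h\<close>, so that the local equations glue to the canonical section.
\<close>

definition bundle_of_divisor :: "'a fun_space \<Rightarrow> 'a set \<Rightarrow> ('a, 'b) line_bundle \<Rightarrow> bool" where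
  "bundle_of_divisor X D L \<longleftrightarrow>
     (\<exists>\<A>. (\<forall>(U, t, h)\<in>\<A>. local_triv X L U t \<and> local_equation X D U h) \<and>
        (\<Union>(U, t, h)\<in>\<A>. U) = points X \<and>
        (\<forall>(U, t, h)\<in>\<A>. \<forall>(U', t', h')\<in>\<A>. \<forall>x\<in>U \<inter> U'. \<forall>v\<in>fibre L x.
           h x * t' v = h' x * t v))"

text \<open>The associated norm is \<open>\<bar>v\<bar>\<^sup>2 = H v v\<close>; it need not be smooth, only continuous.\<close>

definition hermitian_metric ::
    "'a fun_space \<Rightarrow> ('a, 'b) line_bundle \<Rightarrow> ('b \<Rightarrow> 'b \<Rightarrow> complex) \<Rightarrow> bool" where
  "hermitian_metric X L H \<longleftrightarrow>
     (\<forall>x\<in>points X. \<forall>v\<in>fibre L x. \<forall>w\<in>fibre L x.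
        (\<forall>c. H (smul L c v) w = c * H v w) \<and>
        (\<forall>v'\<in>fibre L x. H (vadd L v v') w = H v w + H v' w) \<and>
        H w v = cnj (H v w)) \<and>
     (\<forall>v\<in>nonzero_part L. Re (H v v) > 0) \<and>
     continuous_map (bundle_topology X L) euclidean (\<lambda>v. H v v)"

text \<open>
  Elements of the fibre at \<open>x\<close> of the tensor product over \<open>i \<in> I\<close> of the powers
  \<open>L i ^ (- N i)\<close>: forms in vectors \<open>m i k \<in> fibre (L i) x\<close> (\<open>i \<in> I\<close>, \<open>k < N i\<close>), linear
  in each of them.
\<close>

definition tensor_form ::
    "'i set \<Rightarrow> ('i \<Rightarrow> nat) \<Rightarrow> ('i \<Rightarrow> ('a, 'b) line_bundle) \<Rightarrow> 'a
       \<Rightarrow> (('i \<Rightarrow> nat \<Rightarrow> 'b) \<Rightarrow> complex) \<Rightarrow> bool" where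
  "tensor_form I N L x \<phi> \<longleftrightarrow>
     (\<forall>m m'. (\<forall>i\<in>I. \<forall>k<N i. m i k = m' i k) \<longrightarrow> \<phi> m = \<phi> m') \<and>
     (\<forall>m. (\<forall>i\<in>I. \<forall>k<N i. m i k \<in> fibre (L i) x) \<longrightarrow>
        (\<forall>i\<in>I. \<forall>k<N i.
           (\<forall>c. \<phi> (m(i := (m i)(k := smul (L i) c (m i k)))) = c * \<phi> m) \<and>
           (\<forall>v\<in>fibre (L i) x.
              \<phi> (m(i := (m i)(k := vadd (L i) (m i k) v))) = \<phi> m + \<phi> (m(i := (m i)(k := v))))))"

text \<open>Regularity: the contraction with regular sections of the \<open>L i\<close> is a regular function.\<close>

definition regular_tensor_section ::
    "'a fun_space \<Rightarrow> 'i set \<Rightarrow> ('i \<Rightarrow> nat) \<Rightarrow> ('i \<Rightarrow> ('a, 'b) line_bundle)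
       \<Rightarrow> ('a \<Rightarrow> ('i \<Rightarrow> nat \<Rightarrow> 'b) \<Rightarrow> complex) \<Rightarrow> bool" where
  "regular_tensor_section X I N L u \<longleftrightarrow>
     (\<forall>x\<in>points X. tensor_form I N L x (u x)) \<and>
     (\<forall>U \<sigma>. openin (zariski X) U \<and> (\<forall>i\<in>I. \<forall>k<N i. regular_section X (L i) U (\<sigma> i k)) \<longrightarrow>
        (\<lambda>x. u x (\<lambda>i k. \<sigma> i k x)) \<in> reg X U)"

definition nowhere_vanishing ::
    "'a fun_space \<Rightarrow> 'i set \<Rightarrow> ('i \<Rightarrow> nat) \<Rightarrow> ('i \<Rightarrow> ('a, 'b) line_bundle)
       \<Rightarrow> ('a \<Rightarrow> ('i \<Rightarrow> nat \<Rightarrow> 'b) \<Rightarrow> complex) \<Rightarrow> bool" where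
  "nowhere_vanishing X I N L u \<longleftrightarrow>
     (\<forall>x\<in>points X. \<exists>m. (\<forall>i\<in>I. \<forall>k<N i. m i k \<in> fibre (L i) x) \<and> u x m \<noteq> 0)"

text \<open>The product of \<open>u(x)\<close> with the powers \<open>v i ^ N i\<close>: each \<open>v i\<close> fills \<open>N i\<close> slots.\<close>

definition contract_powers ::
    "('a \<Rightarrow> ('i \<Rightarrow> nat \<Rightarrow> 'b) \<Rightarrow> complex) \<Rightarrow> 'a \<Rightarrow> ('i \<Rightarrow> 'b) \<Rightarrow> complex" where
  "contract_powers u x v = u x (\<lambda>i k. v i)"


section \<open>Quotients and fibre products of spaces\<close>

definition quotient_space :: "'a topology \<Rightarrow> ('a \<times> 'a) set \<Rightarrow> 'a set topology" where
  "quotient_space X r = topology (\<lambda>V. V \<subseteq> topspace X // r \<and> openin X (\<Union>V))"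

lemma Union_Int_quotient:
  assumes "equiv A r" "V \<subseteq> A // r" "W \<subseteq> A // r"
  shows "\<Union>(V \<inter> W) = \<Union>V \<inter> \<Union>W"
proof
  show "\<Union>V \<inter> \<Union>W \<subseteq> \<Union>(V \<inter> W)"
  proof
    fix x assume "x \<in> \<Union>V \<inter> \<Union>W"
    then obtain c d where cd: "c \<in> V" "d \<in> W" "x \<in> c" "x \<in> d" by blast
    then have "c = d" using quotient_disj[OF assms(1)] assms(2,3) by blast
    then show "x \<in> \<Union>(V \<inter> W)" using cd by blast
  qed
qed blast

lemma openin_quotient_space:
  assumes "equiv (topspace X) r"
  shows "openin (quotient_space X r) V \<longleftrightarrow> V \<subseteq> topspace X // r \<and> openin X (\<Union>V)"
proof -
  have "openin X (\<Union>(\<Union>K))" if "\<forall>V\<in>K. openin X (\<Union>V)" for K :: "'a set set set"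
  proof -
    have "\<Union>(\<Union>K) = \<Union>(Union ` K)" by blast
    moreover have "openin X (\<Union>(Union ` K))" using that by (intro openin_Union) blast
    ultimately show ?thesis by (simp only:)
  qed
  then have "istopology (\<lambda>V. V \<subseteq> topspace X // r \<and> openin X (\<Union>V))"
    unfolding istopology_def using Union_Int_quotient[OF assms] by (auto intro!: openin_Int)
  then show ?thesis unfolding quotient_space_def by (simp add: topology_inverse')
qed

text \<open>A point over \<open>x\<close> of the fibre product over \<open>B\<close> is \<open>(x, p)\<close> with \<open>p\<close> extensional on \<open>I\<close>.\<close>

definition fibre_product ::
    "'a topology \<Rightarrow> 'i set \<Rightarrow> ('i \<Rightarrow> 'c topology) \<Rightarrow> ('i \<Rightarrow> 'c \<Rightarrow> 'a) \<Rightarrow> ('a \<times> ('i \<Rightarrow> 'c)) topology"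
  where
  "fibre_product B I Y \<pi> =
     subtopology (prod_topology B (product_topology Y I)) {(x, p). \<forall>i\<in>I. \<pi> i (p i) = x}"


section \<open>Compactified bundles and the complete space\<close>

definition ray :: "('a, 'b) line_bundle \<Rightarrow> 'b \<Rightarrow> real \<Rightarrow> ('b \<times> real) set" where
  "ray L v t = {(smul L (of_real a) v, a * t) | a. a > 0}"

text \<open>
  \<open>compactified X L\<close> is the compactification by a circle at infinity: its points are the rays
  \<open>[(v, t)] = ray L v t\<close>.
\<close>

definition half_space :: "'a fun_space \<Rightarrow> ('a, 'b) line_bundle \<Rightarrow> ('b \<times> real) topology" where
  "half_space X L = subtopology (prod_topology (bundle_topology X L) euclideanreal)
     {(v, t). t \<ge> 0 \<and> (v \<in> nonzero_part L \<or> t \<noteq> 0)}"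

definition compactified :: "'a fun_space \<Rightarrow> ('a, 'b) line_bundle \<Rightarrow> ('b \<times> real) set topology" where
  "compactified X L = quotient_space (half_space X L)
     {((v, t), z). (v, t) \<in> topspace (half_space X L) \<and> z \<in> ray L v t}"

definition base_point :: "('a, 'b) line_bundle \<Rightarrow> ('b \<times> real) set \<Rightarrow> 'a" where
  "base_point L \<theta> = (THE x. \<exists>(v, t)\<in>\<theta>. bproj L v = x)"

definition circle_bundle :: "('a, 'b) line_bundle \<Rightarrow> ('b \<times> real) set set" where
  "circle_bundle L = {ray L v 0 | v. v \<in> nonzero_part L}"

definition top_points ::
    "('a, 'b) line_bundle \<Rightarrow> 'a set \<Rightarrow> ('a \<Rightarrow> 'b) \<Rightarrow> ('b \<times> real) set set" where
  "top_points L D s =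
     {\<theta> \<in> circle_bundle L. base_point L \<theta> \<notin> D \<longrightarrow> \<theta> = ray L (s (base_point L \<theta>)) 0}"

definition cpl_points ::
    "('a, 'b) line_bundle \<Rightarrow> 'a set \<Rightarrow> ('a \<Rightarrow> 'b) \<Rightarrow> ('b \<times> real) set set" where
  "cpl_points L D s = top_points L D s \<union> {ray L v 1 | v. v \<in> nonzero_part L \<and> bproj L v \<in> D}"

definition top_space ::
    "'a fun_space \<Rightarrow> 'i set \<Rightarrow> ('i \<Rightarrow> 'a set) \<Rightarrow> ('i \<Rightarrow> ('a, 'b) line_bundle) \<Rightarrow> ('i \<Rightarrow> 'a \<Rightarrow> 'b)
       \<Rightarrow> ('a \<times> ('i \<Rightarrow> ('b \<times> real) set)) topology" where
  "top_space X I D L s = fibre_product (complex_topology X) I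
     (\<lambda>i. subtopology (compactified X (L i)) (top_points (L i) (D i) (s i)))
     (\<lambda>i. base_point (L i))"

definition cpl_space ::
    "'a fun_space \<Rightarrow> 'i set \<Rightarrow> ('i \<Rightarrow> 'a set) \<Rightarrow> ('i \<Rightarrow> ('a, 'b) line_bundle) \<Rightarrow> ('i \<Rightarrow> 'a \<Rightarrow> 'b)
       \<Rightarrow> ('a \<times> ('i \<Rightarrow> ('b \<times> real) set)) topology" where
  "cpl_space X I D L s = fibre_product (complex_topology X) I
     (\<lambda>i. subtopology (compactified X (L i)) (cpl_points (L i) (D i) (s i)))
     (\<lambda>i. base_point (L i))"

definition open_part ::
    "'a fun_space \<Rightarrow> 'i set \<Rightarrow> ('i \<Rightarrow> 'a set) \<Rightarrow> ('i \<Rightarrow> ('a, 'b) line_bundle) \<Rightarrow> ('i \<Rightarrow> 'a \<Rightarrow> 'b)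
       \<Rightarrow> ('a \<times> ('i \<Rightarrow> ('b \<times> real) set)) topology" where
  "open_part X I D L s = subtopology (cpl_space X I D L s)
     (topspace (cpl_space X I D L s) - topspace (top_space X I D L s))"

text \<open>
  The vectors occurring in the ray \<open>[(v, t)]\<close>, \<open>v \<noteq> 0\<close>, form the class of \<open>v\<close> modulo positive reals.
\<close>

definition direction :: "('b \<times> real) set \<Rightarrow> 'b set" where
  "direction \<theta> = fst ` \<theta>"

definition sign_f ::
    "'i set \<Rightarrow> ('i \<Rightarrow> 'a set) \<Rightarrow> ('i \<Rightarrow> 'a \<Rightarrow> 'b)
       \<Rightarrow> ('a \<Rightarrow> ('i \<Rightarrow> nat \<Rightarrow> 'b) \<Rightarrow> complex)
       \<Rightarrow> 'a \<times> ('i \<Rightarrow> ('b \<times> real) set) \<Rightarrow> complex" where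
  "sign_f I D s u = (\<lambda>(x, p). THE \<sigma>. \<forall>v. (\<forall>j\<in>indices_at I D x. v j \<in> direction (p j)) \<longrightarrow>
     (let w = contract_powers u x (\<lambda>i. if i \<in> indices_at I D x then v i else s i x)
      in \<sigma> = w / of_real (cmod w)))"

definition scale_component ::
    "('a, 'b) line_bundle \<Rightarrow> real \<Rightarrow> ('b \<times> real) set \<Rightarrow> ('b \<times> real) set" where
  "scale_component L l \<theta> =
     (if \<theta> \<in> circle_bundle L then \<theta> else (\<lambda>(v, t). (smul L (of_real l) v, t)) ` \<theta>)"

definition diagonal_act ::
    "'i set \<Rightarrow> ('i \<Rightarrow> ('a, 'b) line_bundle) \<Rightarrow> real
       \<Rightarrow> 'a \<times> ('i \<Rightarrow> ('b \<times> real) set) \<Rightarrow> 'a \<times> ('i \<Rightarrow> ('b \<times> real) set)" where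
  "diagonal_act I L l = (\<lambda>(x, p). (x, \<lambda>i\<in>I. scale_component (L i) l (p i)))"

definition orbit_rel ::
    "'a fun_space \<Rightarrow> 'i set \<Rightarrow> ('i \<Rightarrow> 'a set) \<Rightarrow> ('i \<Rightarrow> ('a, 'b) line_bundle) \<Rightarrow> ('i \<Rightarrow> 'a \<Rightarrow> 'b)
       \<Rightarrow> (('a \<times> ('i \<Rightarrow> ('b \<times> real) set)) \<times> ('a \<times> ('i \<Rightarrow> ('b \<times> real) set))) set" where
  "orbit_rel X I D L s =
     {(p, diagonal_act I L l p) | p l. p \<in> topspace (open_part X I D L s) \<and> l > 0}"


section \<open>A'Campo's second model\<close>

definition std_simplex :: "'i set \<Rightarrow> ('i \<Rightarrow> real) set" where
  "std_simplex I = {\<xi> \<in> extensional I. (\<forall>i\<in>I. \<xi> i \<ge> 0) \<and> (\<Sum>i\<in>I. \<xi> i) = 1}"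

definition divisor_with_simplices ::
    "'a fun_space \<Rightarrow> 'i set \<Rightarrow> ('i \<Rightarrow> 'a set) \<Rightarrow> ('a \<times> ('i \<Rightarrow> real)) topology" where
  "divisor_with_simplices X I D =
     subtopology (prod_topology (complex_topology X) (product_topology (\<lambda>_. euclideanreal) I))
       {(x, \<xi>). x \<in> (\<Union>i\<in>I. D i) \<and> \<xi> \<in> std_simplex I \<and> (\<forall>i\<in>I. x \<notin> D i \<longrightarrow> \<xi> i = 0)}"

definition acampo_space ::
    "'a fun_space \<Rightarrow> 'i set \<Rightarrow> ('i \<Rightarrow> 'a set) \<Rightarrow> ('i \<Rightarrow> ('a, 'b) line_bundle) \<Rightarrow> ('i \<Rightarrow> 'a \<Rightarrow> 'b)
       \<Rightarrow> (('a \<times> ('i \<Rightarrow> real)) \<times> ('a \<times> ('i \<Rightarrow> ('b \<times> real) set))) topology" where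
  "acampo_space X I D L s =
     subtopology
       (prod_topology (divisor_with_simplices X I D)
          (subtopology (top_space X I D L s) {q. fst q \<in> (\<Union>i\<in>I. D i)}))
       {(a, q). fst a = fst q}"

definition acampo_map ::
    "'i set \<Rightarrow> ('i \<Rightarrow> 'a set) \<Rightarrow> ('i \<Rightarrow> 'a \<Rightarrow> 'b) \<Rightarrow> ('a \<Rightarrow> ('i \<Rightarrow> nat \<Rightarrow> 'b) \<Rightarrow> complex)
       \<Rightarrow> ('a \<times> ('i \<Rightarrow> real)) \<times> ('a \<times> ('i \<Rightarrow> ('b \<times> real) set)) \<Rightarrow> complex" where
  "acampo_map I D s u = sign_f I D s u \<circ> snd"

end

theory Submission
  imports Defs
begin

text \<open>
  A nonzero ray \<open>[(v, t)]\<close> of a compactified line bundle is determined by the unit vector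
  \<open>v / |v|\<close> and the number \<open>\<rho> = t / |v| \<ge> 0\<close>, which vanishes exactly at infinity.  A point of
  the complete space over \<open>x\<close> is thus a family of directions \<open>\<theta>\<^sub>i\<close> with a family of numbers
  \<open>\<rho>\<^sub>i \<ge> 0\<close> such that \<open>\<rho>\<^sub>i = 0\<close> when \<open>x \<notin> D\<^sub>i\<close>; it lies outside the oriented blowing-up iff
  \<open>\<rho> \<noteq> 0\<close>, and \<open>\<lambda> > 0\<close> acts by \<open>\<rho> \<mapsto> \<rho> / \<lambda>\<close>.  Normalizing \<open>\<rho>\<close> to have sum 1 maps the
  orbits bijectively to A'Campo's space, with continuous section \<open>(\<xi>, \<theta>) \<mapsto> (\<theta>, \<rho> = \<xi>)\<close>.  The sign of
  \<open>f\<close> depends on the \<open>\<theta>\<^sub>i\<close> only.  It is continuous because in local frames the form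
  \<open>u\<close> is a nowhere vanishing regular function times the product of the coordinates.
\<close>

section \<open>Maps out of quotient spaces\<close>

text \<open>No compactness or Hausdorff argument is needed for the homeomorphism, since the
  continuous section itself provides the inverse. The obstacle is the zero section: a compactified
  bundle contains the rays \<open>[(0, 1)]\<close>, on which division by \<open>|v|\<close> makes no
  sense. Directions and inverse norms therefore live only on the open set of nonzero rays, and the
  universal property of the quotient is used on an open saturated set instead of the whole half
  space. The complete space only involves nonzero rays. The inverse norm is preferred to the norm
  because it stays finite on the circle at infinity, so that finite and infinite components obey the
  same formulas. The metrics merely select a continuous representative of each direction: other
  metrics change the homeomorphism, but neither of the two spaces. For the sign, the difficulty is a
  definition that depends on the stratum of \<open>x\<close>. Off \<open>D i\<close> the value
  \<open>s i x\<close> has the direction recorded in the point, so one formula covers all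
  strata.\<close>

lemma topspace_quotient_space:
  assumes r: "equiv (topspace Y) r"
  shows "topspace (quotient_space Y r) = topspace Y // r"
proof
  show "topspace (quotient_space Y r) \<subseteq> topspace Y // r"
    using openin_quotient_space[OF r, of "topspace (quotient_space Y r)"] by blast
  have "openin (quotient_space Y r) (topspace Y // r)"
    using openin_quotient_space[OF r] Union_quotient[OF r] by simp
  then show "topspace Y // r \<subseteq> topspace (quotient_space Y r)"
    by (rule openin_subset)
qed

text \<open>The preimage of a set \<open>V\<close> of classes is \<open>\<Union>V\<close>, which is
  what the quotient topology requires to be open.\<close>

lemma continuous_map_quotient_class:
  assumes r: "equiv (topspace Y) r"
  shows "continuous_map Y (quotient_space Y r) (\<lambda>p. r `` {p})"
  unfolding continuous_map
proof (intro conjI allI impI)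
  show "(\<lambda>p. r `` {p}) ` topspace Y \<subseteq> topspace (quotient_space Y r)"
    by (auto simp: topspace_quotient_space[OF r] quotientI)
  fix V assume "openin (quotient_space Y r) V"
  then have V: "V \<subseteq> topspace Y // r" "openin Y (\<Union>V)"
    using openin_quotient_space[OF r] by auto
  have "{p \<in> topspace Y. r `` {p} \<in> V} = \<Union>V"
  proof (intro set_eqI iffI)
    fix p assume "p \<in> {p \<in> topspace Y. r `` {p} \<in> V}"
    then show "p \<in> \<Union>V" using equiv_class_self[OF r] by blast
  next
    fix p assume "p \<in> \<Union>V"
    then obtain c where c: "c \<in> V" "p \<in> c" by blast
    then have "p \<in> topspace Y" using V(2) openin_subset by fastforce
    moreover have "c = r `` {p}"
      using c V(1) r by (metis Image_singleton_iff equiv_class_eq quotientE subsetD)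
    ultimately show "p \<in> {p \<in> topspace Y. r `` {p} \<in> V}" using c by simp
  qed
  then show "openin Y {p \<in> topspace Y. r `` {p} \<in> V}" using V(2) by simp
qed

text \<open>A quotient topology need not restrict well to a subset, but it does for an open
  saturated \<open>A\<close>: the classes that \<open>g\<close> sends into \<open>W\<close> fill a
  set that is open in \<open>A\<close>, hence in \<open>Y\<close>. The restriction serves the
  nonzero rays, which are only a part of a compactified bundle.\<close>

lemma continuous_map_from_quotient:
  assumes r: "equiv (topspace Y) r" and A: "openin Y A"
    and sat: "\<And>p q. p \<in> A \<Longrightarrow> (p, q) \<in> r \<Longrightarrow> q \<in> A"
    and F: "continuous_map (subtopology Y A) Z F"
    and g: "\<And>p. p \<in> A \<Longrightarrow> g (r `` {p}) = F p"
  shows "continuous_map (subtopology (quotient_space Y r) ((\<lambda>p. r `` {p}) ` A)) Z g"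
proof -
  have AY: "A \<subseteq> topspace Y" using A by (rule openin_subset)
  have top: "topspace (subtopology (quotient_space Y r) ((\<lambda>p. r `` {p}) ` A))
      = (\<lambda>p. r `` {p}) ` A"
    using AY by (auto simp: topspace_quotient_space[OF r] intro: quotientI)
  show ?thesis
    unfolding continuous_map
  proof (intro conjI allI impI)
    show "g ` topspace (subtopology (quotient_space Y r) ((\<lambda>p. r `` {p}) ` A)) \<subseteq> topspace Z"
      unfolding top using F g AY by (auto simp: continuous_map_def)
    fix W assume "openin Z W"
    then have "openin (subtopology Y A) {p \<in> topspace (subtopology Y A). F p \<in> W}"
      using F by (rule openin_continuous_map_preimage[rotated])
    moreover have "{p \<in> topspace (subtopology Y A). F p \<in> W} = {p \<in> A. F p \<in> W}"
      using AY by auto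
    ultimately have op: "openin Y {p \<in> A. F p \<in> W}" using A openin_trans_full by metis
    define V where "V = {c \<in> (\<lambda>p. r `` {p}) ` A. g c \<in> W}"
    have "\<Union>V = {p \<in> A. F p \<in> W}"
    proof (intro set_eqI iffI)
      fix q assume "q \<in> \<Union>V"
      then obtain p where p: "p \<in> A" "g (r `` {p}) \<in> W" "(p, q) \<in> r" unfolding V_def by blast
      then have "q \<in> A" "r `` {p} = r `` {q}" using sat equiv_class_eq[OF r] by blast+
      then show "q \<in> {p \<in> A. F p \<in> W}" using p g by auto
    next
      fix p assume "p \<in> {p \<in> A. F p \<in> W}"
      then show "p \<in> \<Union>V"
        using g equiv_class_self[OF r] AY unfolding V_def by auto
    qed
    moreover have "V \<subseteq> topspace Y // r" unfolding V_def using AY by (auto intro: quotientI)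
    ultimately have "openin (quotient_space Y r) V" using op by (simp add: openin_quotient_space[OF r])
    then show "openin (subtopology (quotient_space Y r) ((\<lambda>p. r `` {p}) ` A))
        {c \<in> topspace (subtopology (quotient_space Y r) ((\<lambda>p. r `` {p}) ` A)). g c \<in> W}"
      unfolding top openin_subtopology V_def[symmetric] by (auto simp: V_def)
  qed
qed

text \<open>The section \<open>K\<close> replaces a proof that \<open>F\<close> is open: the inverse
  sends \<open>z\<close> to the class of \<open>K z\<close>. It is an inverse on the other side
  because \<open>F (K (F p)) = F p\<close> puts \<open>p\<close> and \<open>K (F p)\<close> in one
  class.\<close>

lemma homeomorphic_map_from_quotient:
  assumes r: "equiv (topspace Y) r"
    and F: "continuous_map Y Z F" and K: "continuous_map Z Y K"
    and FK: "\<And>z. z \<in> topspace Z \<Longrightarrow> F (K z) = z"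
    and ker: "\<And>p q. p \<in> topspace Y \<Longrightarrow> q \<in> topspace Y \<Longrightarrow> (p, q) \<in> r \<longleftrightarrow> F p = F q"
  shows "\<exists>h. homeomorphic_map (quotient_space Y r) Z h \<and> (\<forall>p\<in>topspace Y. h (r `` {p}) = F p)"
proof -
  define h where "h = (\<lambda>c. F (SOME p. p \<in> c))"
  have hp: "h (r `` {p}) = F p" if "p \<in> topspace Y" for p
  proof -
    have "p \<in> r `` {p}" using equiv_class_self[OF r that] .
    then have "(p, SOME q. q \<in> r `` {p}) \<in> r" by (metis someI Image_singleton_iff)
    moreover from this have "(SOME q. q \<in> r `` {p}) \<in> topspace Y"
      using equiv_type[OF r] by blast
    ultimately show ?thesis unfolding h_def using ker that by metis
  qed
  note top = topspace_quotient_space[OF r]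
  have "(\<lambda>p. r `` {p}) ` topspace Y = topspace Y // r" by (auto simp: quotient_def)
  then have hcont: "continuous_map (quotient_space Y r) Z h"
    using continuous_map_from_quotient[OF r openin_topspace, of Z F h] F hp
      equiv_type[OF r] by (metis mem_Sigma_iff subsetD subtopology_topspace top)
  have "homeomorphic_maps (quotient_space Y r) Z h (\<lambda>z. r `` {K z})"
    unfolding homeomorphic_maps_def
  proof (intro conjI ballI)
    show "continuous_map Z (quotient_space Y r) (\<lambda>z. r `` {K z})"
      using continuous_map_compose[OF K continuous_map_quotient_class[OF r]] by (simp add: o_def)
    have KY: "K z \<in> topspace Y" if "z \<in> topspace Z" for z
      using K that by (auto simp: continuous_map_def)
    show "h (r `` {K z}) = z" if "z \<in> topspace Z" for z
      using hp FK KY that by simp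
    fix c assume "c \<in> topspace (quotient_space Y r)"
    then obtain p where p: "p \<in> topspace Y" "c = r `` {p}" by (auto simp: top elim: quotientE)
    have FZ: "F p \<in> topspace Z" using F p by (auto simp: continuous_map_def)
    then have "(p, K (F p)) \<in> r" using ker p KY FK by metis
    then show "r `` {K (h c)} = c" using p hp equiv_class_eq[OF r] by metis
  qed (fact hcont)
  then show ?thesis using hp homeomorphic_map_maps by blast
qed


section \<open>Fibre products and locally continuous maps\<close>

text \<open>Passing to limits at points makes the \<open>tendsto\<close> rules for products, powers,
  roots and \<open>sgn\<close> available on an abstract topology.\<close>

lemma continuous_map_euclidean_tendsto:
  "continuous_map T euclidean f \<longleftrightarrow> (\<forall>x\<in>topspace T. (f \<longlongrightarrow> f x) (atin T x))"
  by (simp add: continuous_map_atin)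

lemma continuous_map_locally:
  assumes "\<And>y. y \<in> topspace Y \<Longrightarrow> \<exists>U. openin Y U \<and> y \<in> U \<and> continuous_map (subtopology Y U) Z f"
  shows "continuous_map Y Z f"
  by (rule pasting_lemma[of "{U. openin Y U \<and> continuous_map (subtopology Y U) Z f}" Y "\<lambda>U. U" Z "\<lambda>_. f"])
    (use assms in blast)+

lemma topspace_fibre_product:
  assumes "\<And>i. i \<in> I \<Longrightarrow> P i \<subseteq> topspace (C i)"
  shows "(x, p) \<in> topspace (fibre_product B I (\<lambda>i. subtopology (C i) (P i)) \<pi>) \<longleftrightarrow>
    x \<in> topspace B \<and> p \<in> extensional I \<and> (\<forall>i\<in>I. p i \<in> P i \<and> \<pi> i (p i) = x)"
  using assms unfolding fibre_product_def by (auto simp: PiE_iff)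

lemma continuous_map_fibre_product_base: "continuous_map (fibre_product B I Y \<pi>) B fst"
  unfolding fibre_product_def by (intro continuous_map_from_subtopology continuous_map_fst)

lemma continuous_map_fibre_product_component:
  assumes "i \<in> I" shows "continuous_map (fibre_product B I Y \<pi>) (Y i) (\<lambda>q. snd q i)"
proof -
  have "continuous_map (prod_topology B (product_topology Y I)) (Y i) ((\<lambda>p. p i) \<circ> snd)"
    using continuous_map_snd continuous_map_product_projection[OF assms] by (rule continuous_map_compose)
  then show ?thesis
    unfolding fibre_product_def by (intro continuous_map_from_subtopology) (simp add: o_def)
qed

lemma continuous_map_into_fibre_product:
  assumes "continuous_map Z B (\<lambda>z. fst (g z))"
    and "\<And>i. i \<in> I \<Longrightarrow> continuous_map Z (C i) (\<lambda>z. snd (g z) i)"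
    and "\<And>z. z \<in> topspace Z \<Longrightarrow> snd (g z) \<in> extensional I"
    and "\<And>z i. z \<in> topspace Z \<Longrightarrow> i \<in> I \<Longrightarrow> snd (g z) i \<in> P i \<and> \<pi> i (snd (g z) i) = fst (g z)"
  shows "continuous_map Z (fibre_product B I (\<lambda>i. subtopology (C i) (P i)) \<pi>) g"
  unfolding fibre_product_def using assms
  by (auto simp: continuous_map_in_subtopology continuous_map_pairwise continuous_map_componentwise o_def
      split: prod.splits) (metis fst_conv snd_conv)+


section \<open>Hermitian line bundles and their compactifications\<close>

lemma reg_cong:
  assumes "function_sheaf X" "openin (zariski X) U" "g \<in> reg X U" "\<And>x. x \<in> U \<Longrightarrow> h x = g x"
  shows "h \<in> reg X U"
proof -
  have "\<forall>U g h. openin (zariski X) U \<and> g \<in> reg X U \<and> (\<forall>x\<in>U. h x = g x) \<longrightarrow> h \<in> reg X U"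
    using assms(1) unfolding function_sheaf_def by (elim conjE)
  from this[rule_format, of U g h] show ?thesis using assms by simp
qed

lemma reg_mono:
  assumes "function_sheaf X" "openin (zariski X) U" "g \<in> reg X U" "openin (zariski X) V" "V \<subseteq> U"
  shows "g \<in> reg X V"
proof -
  have "\<forall>U V g. openin (zariski X) U \<and> openin (zariski X) V \<and> V \<subseteq> U \<and> g \<in> reg X U
      \<longrightarrow> g \<in> reg X V"
    using assms(1) unfolding function_sheaf_def by (elim conjE)
  from this[rule_format, of U V g] show ?thesis using assms by simp
qed

text \<open>A generator of \<open>complex_topology\<close> needs some regular function on its
  Zariski open set \<open>U\<close>, and the sheaf conditions provide none on a nonempty
  \<open>U\<close>. One function regular on the whole space, restricted to \<open>U\<close>, makes
  \<open>U\<close> itself open.\<close>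

locale function_space =
  fixes X :: "'a fun_space"
  assumes sheaf: "function_sheaf X"
    and global_function: "reg X (points X) \<noteq> {}"
begin

lemma openin_complex_topology:
  assumes "openin (zariski X) U" shows "openin (complex_topology X) U"
proof -
  obtain f where "f \<in> reg X (points X)" using global_function by blast
  then have "f \<in> reg X U"
    by (rule reg_mono[OF sheaf openin_topspace _ assms openin_subset[OF assms]])
  moreover have "U = {x \<in> U. f x \<in> UNIV}" by simp
  ultimately show ?thesis
    unfolding complex_topology_def using assms open_UNIV by (intro topology_generated_by_Basis) blast
qed

lemma topspace_complex_topology [simp]: "topspace (complex_topology X) = points X"
proof
  show "topspace (complex_topology X) \<subseteq> points X"
    unfolding complex_topology_def by (auto dest: openin_subset)
  show "points X \<subseteq> topspace (complex_topology X)"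
    using openin_complex_topology[OF openin_topspace] openin_subset by blast
qed

lemma continuous_map_reg:
  assumes "openin (zariski X) U" "g \<in> reg X U"
  shows "continuous_map (subtopology (complex_topology X) U) euclidean g"
  unfolding continuous_map
proof (intro conjI allI impI)
  fix W :: "complex set" assume "openin euclidean W"
  then have "openin (complex_topology X) {x \<in> U. g x \<in> W}"
    unfolding complex_topology_def using assms open_openin[of W]
    by (intro topology_generated_by_Basis) blast
  moreover have "{x \<in> topspace (subtopology (complex_topology X) U). g x \<in> W} = {x \<in> U. g x \<in> W}"
    using openin_subset[OF assms(1)] by auto
  ultimately show "openin (subtopology (complex_topology X) U)
      {x \<in> topspace (subtopology (complex_topology X) U). g x \<in> W}"
    by (auto simp: openin_subtopology)
qed auto

end

locale hermitian_line_bundle = function_space X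
  for X :: "'a fun_space" +
  fixes L :: "('a, 'b) line_bundle" and H :: "'b \<Rightarrow> 'b \<Rightarrow> complex"
  assumes algebraic: "algebraic_line_bundle X L"
    and metric: "hermitian_metric X L H"
begin

section \<open>Charts and scalar multiplication\<close>

lemma atlasD:
  assumes "(U, t) \<in> atlas L"
  shows "openin (zariski X) U" and "U \<subseteq> points X"
    and "x \<in> U \<Longrightarrow> bij_betw t (fibre L x) UNIV"
    and "v \<in> total L \<Longrightarrow> bproj L v \<in> U \<Longrightarrow> t (smul L c v) = c * t v"
    and "(U', t') \<in> atlas L \<Longrightarrow> \<exists>g\<in>reg X (U \<inter> U'). \<forall>x\<in>U \<inter> U'. g x \<noteq> 0 \<and> (\<forall>v\<in>fibre L x. t' v = g x * t v)"
proof -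
  have l: "local_triv X L U t" using assms algebraic unfolding algebraic_line_bundle_def by auto
  then show "openin (zariski X) U" unfolding local_triv_def by blast
  then show "U \<subseteq> points X" by (rule openin_subset)
  show "x \<in> U \<Longrightarrow> bij_betw t (fibre L x) UNIV" using l unfolding local_triv_def by blast
  show "v \<in> total L \<Longrightarrow> bproj L v \<in> U \<Longrightarrow> t (smul L c v) = c * t v"
    using l unfolding local_triv_def fibre_def by blast
  show "(U', t') \<in> atlas L \<Longrightarrow> \<exists>g\<in>reg X (U \<inter> U'). \<forall>x\<in>U \<inter> U'. g x \<noteq> 0 \<and> (\<forall>v\<in>fibre L x. t' v = g x * t v)"
    using l unfolding local_triv_def by blast
qed

lemma atlas_covers:
  assumes "x \<in> points X" obtains U t where "(U, t) \<in> atlas L" "x \<in> U"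
proof -
  have "(\<Union>(U, t)\<in>atlas L. U) = points X" using algebraic unfolding algebraic_line_bundle_def by simp
  then have "x \<in> (\<Union>(U, t)\<in>atlas L. U)" using assms by simp
  then show ?thesis using that by auto
qed

lemma bproj_points: "v \<in> total L \<Longrightarrow> bproj L v \<in> points X"
proof -
  have "bproj L ` total L \<subseteq> points X" using algebraic unfolding algebraic_line_bundle_def by (elim conjE)
  then show "v \<in> total L \<Longrightarrow> bproj L v \<in> points X" by blast
qed

lemma smul_total [simp]:
  assumes "v \<in> total L"
  shows "smul L c v \<in> total L" and "bproj L (smul L c v) = bproj L v"
proof -
  have "\<forall>x\<in>points X. \<forall>v\<in>fibre L x. (\<forall>c. smul L c v \<in> fibre L x) \<and>
      (\<forall>w\<in>fibre L x. vadd L v w \<in> fibre L x)"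
    using algebraic unfolding algebraic_line_bundle_def by (elim conjE)
  from this[rule_format, of "bproj L v" v] have "smul L c v \<in> fibre L (bproj L v)"
    using assms bproj_points by (auto simp: fibre_def)
  then show "smul L c v \<in> total L" "bproj L (smul L c v) = bproj L v" unfolding fibre_def by auto
qed

lemma chart_inject:
  assumes "(U, t) \<in> atlas L" "v \<in> total L" "w \<in> total L" "bproj L v \<in> U" "bproj L w = bproj L v"
  shows "t v = t w \<longleftrightarrow> v = w"
  using atlasD(3)[OF assms(1,4)] assms unfolding bij_betw_def inj_on_def fibre_def by auto

lemma smul_smul [simp]:
  assumes "v \<in> total L" shows "smul L a (smul L b v) = smul L (a * b) v"
proof -
  obtain U t where U: "(U, t) \<in> atlas L" "bproj L v \<in> U" using atlas_covers bproj_points[OF assms] by blast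
  show ?thesis
    by (subst chart_inject[OF U(1), symmetric]) (use assms U in \<open>auto simp: atlasD(4)[OF U(1)]\<close>)
qed

lemma smul_one [simp]:
  assumes "v \<in> total L" shows "smul L 1 v = v"
proof -
  obtain U t where U: "(U, t) \<in> atlas L" "bproj L v \<in> U" using atlas_covers bproj_points[OF assms] by blast
  show ?thesis
    by (subst chart_inject[OF U(1), symmetric]) (use assms U in \<open>auto simp: atlasD(4)[OF U(1)]\<close>)
qed

lemma nonzero_total: "v \<in> nonzero_part L \<Longrightarrow> v \<in> total L"
  unfolding nonzero_part_def by blast

text \<open>The coordinate \<open>t\<close> is injective on fibres and sends
  \<open>smul L 0 v\<close> to 0.\<close>

lemma nonzero_iff_chart:
  assumes "(U, t) \<in> atlas L" "v \<in> total L" "bproj L v \<in> U"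
  shows "v \<in> nonzero_part L \<longleftrightarrow> t v \<noteq> 0"
proof -
  have "t (smul L 0 v) = t v \<longleftrightarrow> smul L 0 v = v"
    by (rule chart_inject[OF assms(1)]) (use assms in simp_all)
  moreover have "t (smul L 0 v) = 0" using atlasD(4)[OF assms, of 0] by (metis mult_zero_left)
  ultimately show ?thesis using assms(2) unfolding nonzero_part_def mem_Collect_eq by metis
qed

lemma smul_nonzero [simp]:
  assumes "v \<in> nonzero_part L" "c \<noteq> 0" shows "smul L c v \<in> nonzero_part L"
proof -
  have v: "v \<in> total L" using assms nonzero_total by blast
  obtain U t where U: "(U, t) \<in> atlas L" "bproj L v \<in> U" using atlas_covers bproj_points[OF v] by blast
  show ?thesis
    using nonzero_iff_chart[OF U(1)] assms v U atlasD(4)[OF U(1)] by auto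
qed

section \<open>The topology of the total space\<close>

lemma topspace_bundle_topology [simp]: "topspace (bundle_topology X L) = total L"
proof -
  have "v \<in> \<Union>{{v \<in> total L. bproj L v \<in> A \<inter> U \<and> t v \<in> W} | A U t W.
        openin (complex_topology X) A \<and> (U, t) \<in> atlas L \<and> open W}" if v: "v \<in> total L" for v
  proof -
    obtain U t where U: "(U, t) \<in> atlas L" "bproj L v \<in> U" using atlas_covers bproj_points[OF v] by blast
    have "{v \<in> total L. bproj L v \<in> points X \<inter> U \<and> t v \<in> UNIV} \<in>
        {{v \<in> total L. bproj L v \<in> A \<inter> U \<and> t v \<in> W} | A U t W.
          openin (complex_topology X) A \<and> (U, t) \<in> atlas L \<and> open W}"
      using U(1) openin_topspace[of "complex_topology X"] open_UNIV
      unfolding topspace_complex_topology by blast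
    then show ?thesis by (rule UnionI) (use v U(2) bproj_points[OF v] in simp)
  qed
  then show ?thesis unfolding bundle_topology_def by auto
qed

lemma openin_bundle_topology:
  assumes "openin (complex_topology X) A" "(U, t) \<in> atlas L" "open W"
  shows "openin (bundle_topology X L) {v \<in> total L. bproj L v \<in> A \<inter> U \<and> t v \<in> W}"
  unfolding bundle_topology_def using assms by (intro topology_generated_by_Basis) blast

lemma continuous_map_bproj: "continuous_map (bundle_topology X L) (complex_topology X) (bproj L)"
  unfolding continuous_map
proof (intro conjI allI impI)
  show "bproj L ` topspace (bundle_topology X L) \<subseteq> topspace (complex_topology X)"
    using bproj_points by auto
  fix A assume A: "openin (complex_topology X) A"
  have "{v \<in> topspace (bundle_topology X L). bproj L v \<in> A}
      = (\<Union>(U, t)\<in>atlas L. {v \<in> total L. bproj L v \<in> A \<inter> U \<and> t v \<in> UNIV})"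
    using bproj_points by (auto elim: atlas_covers)
  also have "openin (bundle_topology X L) \<dots>"
    by (intro openin_Union, clarify) (rule openin_bundle_topology[OF A _ open_UNIV])
  finally show "openin (bundle_topology X L) {v \<in> topspace (bundle_topology X L). bproj L v \<in> A}" .
qed

lemma continuous_map_chart:
  assumes "(U, t) \<in> atlas L"
  shows "continuous_map (subtopology (bundle_topology X L) {v. bproj L v \<in> U}) euclidean t"
  unfolding continuous_map
proof (intro conjI allI impI)
  fix W :: "complex set" assume "openin euclidean W"
  then have "openin (bundle_topology X L) {v \<in> total L. bproj L v \<in> points X \<inter> U \<and> t v \<in> W}"
    using openin_bundle_topology[OF _ assms] openin_topspace[of "complex_topology X"] by simp
  moreover have "{v \<in> topspace (subtopology (bundle_topology X L) {v. bproj L v \<in> U}). t v \<in> W}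
      = {v \<in> total L. bproj L v \<in> points X \<inter> U \<and> t v \<in> W}" using bproj_points by auto
  ultimately show "openin (subtopology (bundle_topology X L) {v. bproj L v \<in> U})
      {v \<in> topspace (subtopology (bundle_topology X L) {v. bproj L v \<in> U}). t v \<in> W}"
    by (auto simp: openin_subtopology)
qed auto

text \<open>The generating open sets combine a condition on the base point with a condition on one
  chart coordinate, so these two kinds of maps suffice to test continuity.\<close>

lemma continuous_map_into_bundle:
  assumes \<phi>: "\<And>y. y \<in> topspace Y \<Longrightarrow> \<phi> y \<in> total L"
    and b: "continuous_map Y (complex_topology X) (\<lambda>y. bproj L (\<phi> y))"
    and t: "\<And>U t. (U, t) \<in> atlas L \<Longrightarrow>
      continuous_map (subtopology Y {y. bproj L (\<phi> y) \<in> U}) euclidean (\<lambda>y. t (\<phi> y))"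
  shows "continuous_map Y (bundle_topology X L) \<phi>"
proof -
  have pre: "openin Y (\<phi> -` {v \<in> total L. bproj L v \<in> A \<inter> U \<and> t v \<in> W} \<inter> topspace Y)"
    if A: "openin (complex_topology X) A" and U: "(U, t) \<in> atlas L" and W: "open W" for A U t W
  proof -
    let ?Y = "subtopology Y {y. bproj L (\<phi> y) \<in> U}"
    have oU: "openin Y {y \<in> topspace Y. bproj L (\<phi> y) \<in> U}"
      using b openin_complex_topology[OF atlasD(1)[OF U]] by (rule openin_continuous_map_preimage)
    \<comment> \<open>The coordinate is controlled only over \<open>U\<close>, so this preimage is
      open merely in \<open>?Y\<close>. Intersecting with the open preimage of \<open>U\<close>
      gives a set open in \<open>Y\<close>.\<close>
    have "openin ?Y {y \<in> topspace ?Y. t (\<phi> y) \<in> W}"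
      using t[OF U] W by (intro openin_continuous_map_preimage) (auto simp: open_openin[symmetric])
    then obtain T where T: "openin Y T" "{y \<in> topspace ?Y. t (\<phi> y) \<in> W} = T \<inter> {y. bproj L (\<phi> y) \<in> U}"
      unfolding openin_subtopology by blast
    have "\<phi> -` {v \<in> total L. bproj L v \<in> A \<inter> U \<and> t v \<in> W} \<inter> topspace Y
        = {y \<in> topspace Y. bproj L (\<phi> y) \<in> A} \<inter> ({y \<in> topspace Y. bproj L (\<phi> y) \<in> U} \<inter> T)"
      using T(2) \<phi> openin_subset[OF T(1)] by auto
    then show ?thesis using oU T(1) openin_continuous_map_preimage[OF b A] by (simp add: openin_Int)
  qed
  have "\<phi> ` topspace Y \<subseteq> topspace (bundle_topology X L)" using \<phi> by auto
  then show ?thesis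
    unfolding bundle_topology_def topology_generated_by_topspace
    by (intro continuous_on_generated_topo) (use pre in auto)
qed

lemma continuous_map_smul:
  assumes \<phi>: "continuous_map Y (bundle_topology X L) \<phi>" and a: "continuous_map Y euclidean a"
  shows "continuous_map Y (bundle_topology X L) (\<lambda>y. smul L (a y) (\<phi> y))"
proof (rule continuous_map_into_bundle)
  have tot: "\<phi> y \<in> total L" if "y \<in> topspace Y" for y
    using \<phi> that by (auto simp: continuous_map_def)
  then show "\<And>y. y \<in> topspace Y \<Longrightarrow> smul L (a y) (\<phi> y) \<in> total L" by simp
  show "continuous_map Y (complex_topology X) (\<lambda>y. bproj L (smul L (a y) (\<phi> y)))"
    using continuous_map_compose[OF \<phi> continuous_map_bproj] 
    by (rule continuous_map_eq) (simp add: tot)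
  fix U t assume U: "(U, t) \<in> atlas L"
  let ?Y = "subtopology Y {y. bproj L (smul L (a y) (\<phi> y)) \<in> U}"
  have "continuous_map ?Y (subtopology (bundle_topology X L) {v. bproj L v \<in> U}) \<phi>"
    using \<phi> tot by (auto simp: continuous_map_in_subtopology continuous_map_from_subtopology)
  then have "continuous_map ?Y euclidean (t \<circ> \<phi>)"
    using continuous_map_chart[OF U] by (rule continuous_map_compose)
  moreover have "continuous_map ?Y euclidean a" using a by (rule continuous_map_from_subtopology)
  ultimately have "continuous_map ?Y euclidean (\<lambda>y. a y * t (\<phi> y))"
    unfolding continuous_map_euclidean_tendsto o_def by (auto intro!: tendsto_mult)
  then show "continuous_map ?Y euclidean (\<lambda>y. t (smul L (a y) (\<phi> y)))"
    by (rule continuous_map_eq) (auto simp: atlasD(4)[OF U] tot)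
qed

section \<open>The norm of a Hermitian metric\<close>

definition vnorm :: "'b \<Rightarrow> real" where
  "vnorm v = sqrt (Re (H v v))"

lemma vnorm_pos [simp]: "v \<in> nonzero_part L \<Longrightarrow> vnorm v > 0"
proof -
  have "\<forall>v\<in>nonzero_part L. Re (H v v) > 0"
    using metric unfolding hermitian_metric_def by (elim conjE)
  then show "v \<in> nonzero_part L \<Longrightarrow> vnorm v > 0" unfolding vnorm_def by (metis real_sqrt_gt_0_iff)
qed

lemma vnorm_smul:
  assumes "v \<in> total L" "a \<ge> 0" shows "vnorm (smul L (of_real a) v) = a * vnorm v"
proof -
  let ?w = "smul L (of_real a) v"
  have v: "v \<in> fibre L (bproj L v)" "?w \<in> fibre L (bproj L v)" "bproj L v \<in> points X"
    using assms bproj_points by (auto simp: fibre_def)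
  have "\<forall>x\<in>points X. \<forall>v\<in>fibre L x. \<forall>w\<in>fibre L x.
      (\<forall>c. H (smul L c v) w = c * H v w) \<and>
      (\<forall>v'\<in>fibre L x. H (vadd L v v') w = H v w + H v' w) \<and> H w v = cnj (H v w)"
    using metric unfolding hermitian_metric_def by (elim conjE)
  from this[rule_format, OF v(3)] have lin: "\<And>v' w c. v' \<in> fibre L (bproj L v) \<Longrightarrow> w \<in> fibre L (bproj L v) \<Longrightarrow>
      H (smul L c v') w = c * H v' w \<and> H w v' = cnj (H v' w)"
    by blast
  \<comment> \<open>The form is linear in its first argument; Hermitian symmetry extracts the scalar
    from the second.\<close>
  have "H ?w ?w = a * H v ?w" using lin v by blast
  also have "H v ?w = cnj (H ?w v)" using lin[OF v(2,1)] by blast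
  also have "H ?w v = a * H v v" using lin[OF v(1,1)] by blast
  finally have "Re (H ?w ?w) = a\<^sup>2 * Re (H v v)" by (simp add: power2_eq_square)
  then show ?thesis unfolding vnorm_def using assms by (simp add: real_sqrt_mult)
qed

lemma continuous_map_vnorm: "continuous_map (bundle_topology X L) euclidean vnorm"
proof -
  have "continuous_map (bundle_topology X L) euclidean (\<lambda>v. H v v)"
    using metric unfolding hermitian_metric_def by simp
  then show ?thesis
    unfolding continuous_map_euclidean_tendsto vnorm_def
    by (intro ballI tendsto_real_sqrt tendsto_Re) (rule bspec)
qed

section \<open>Rays and polar coordinates on the compactified bundle\<close>

lemma mem_half_space:
  "(v, t) \<in> topspace (half_space X L) \<longleftrightarrow> v \<in> total L \<and> t \<ge> 0 \<and> (v \<in> nonzero_part L \<or> t \<noteq> 0)"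
  unfolding half_space_def by auto

lemma mem_ray: "z \<in> ray L v t \<longleftrightarrow> (\<exists>a>0. z = (smul L (of_real a) v, a * t))"
  unfolding ray_def by auto

lemma ray_self: "v \<in> total L \<Longrightarrow> (v, t) \<in> ray L v t"
  unfolding mem_ray by (rule exI[of _ 1]) simp

lemma ray_smul:
  assumes "v \<in> total L" "a > 0"
  shows "ray L (smul L (of_real a) v) (a * t) = ray L v t"
proof (intro set_eqI iffI)
  fix z assume "z \<in> ray L (smul L (of_real a) v) (a * t)"
  then obtain b where "b > 0" "z = (smul L (of_real b) (smul L (of_real a) v), b * (a * t))"
    unfolding mem_ray by blast
  then show "z \<in> ray L v t"
    unfolding mem_ray using assms by (intro exI[of _ "b * a"]) (simp add: mult.assoc)
next
  fix z assume "z \<in> ray L v t"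
  then obtain b where "b > 0" "z = (smul L (of_real b) v, b * t)" unfolding mem_ray by blast
  then show "z \<in> ray L (smul L (of_real a) v) (a * t)"
    unfolding mem_ray using assms by (intro exI[of _ "b / a"]) simp
qed

abbreviation ray_rel :: "(('b \<times> real) \<times> ('b \<times> real)) set" where
  "ray_rel \<equiv> {((v, t), z). (v, t) \<in> topspace (half_space X L) \<and> z \<in> ray L v t}"

lemma half_space_ray:
  assumes "(v, t) \<in> topspace (half_space X L)" "z \<in> ray L v t"
  shows "z \<in> topspace (half_space X L)"
proof -
  obtain a where a: "a > 0" "z = (smul L (of_real a) v, a * t)" using assms(2) unfolding mem_ray by blast
  then show ?thesis using assms(1) by (auto simp: mem_half_space)
qed

lemma equiv_ray_rel: "equiv (topspace (half_space X L)) ray_rel"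
proof (rule equivI)
  show "ray_rel \<subseteq> topspace (half_space X L) \<times> topspace (half_space X L)"
    using half_space_ray by blast
  show "refl_on (topspace (half_space X L)) ray_rel"
    using ray_self by (auto simp: refl_on_def mem_half_space)
  \<comment> \<open>Every point of a ray spans the same ray; symmetry and transitivity both follow
    from this.\<close>
  have ray_eq: "ray L (fst z) (snd z) = ray L v t"
    if vt: "(v, t) \<in> topspace (half_space X L)" and z: "z \<in> ray L v t" for v t z
  proof -
    obtain a where a: "a > 0" "z = (smul L (of_real a) v, a * t)" using z unfolding mem_ray by blast
    then show ?thesis using ray_smul[OF _ a(1)] vt by (simp add: mem_half_space)
  qed
  show "sym ray_rel"
  proof (rule symI, clarify)
    fix v t w r assume A: "(v, t) \<in> topspace (half_space X L)" "(w, r) \<in> ray L v t"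
    have "(v, t) \<in> ray L v t" using A(1) by (intro ray_self) (simp add: mem_half_space)
    then show "(w, r) \<in> topspace (half_space X L) \<and> (v, t) \<in> ray L w r"
      using ray_eq[OF A] half_space_ray[OF A] by simp
  qed
  show "trans ray_rel"
  proof (rule transI, clarify)
    fix v t w r z assume A: "(v, t) \<in> topspace (half_space X L)" "(w, r) \<in> ray L v t"
      and z: "z \<in> ray L w r"
    then show "z \<in> ray L v t" using ray_eq[OF A] by simp
  qed
qed

lemma ray_rel_class: "(v, t) \<in> topspace (half_space X L) \<Longrightarrow> ray_rel `` {(v, t)} = ray L v t"
  by auto

lemma continuous_map_ray:
  "continuous_map (half_space X L) (compactified X L) (\<lambda>(v, t). ray L v t)"
  unfolding compactified_def
  by (rule continuous_map_eq[OF continuous_map_quotient_class[OF equiv_ray_rel]]) auto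

text \<open>The complement of the zero section in the compactification: the circle at infinity for
  \<open>t = 0\<close>, the finite nonzero vectors \<open>v / t\<close> for \<open>t > 0\<close>.
  Each of these rays contains a unit vector, unlike the rays \<open>[(0, t)]\<close>.\<close>

definition nonzero_rays :: "('b \<times> real) set set" where
  "nonzero_rays = {ray L v t | v t. v \<in> nonzero_part L \<and> t \<ge> 0}"

text \<open>Moves a pair with \<open>v\<close> nonzero along its ray until the vector has norm 1.
  The second component is then the inverse of the norm of the finite vector \<open>v / t\<close>, or
  0 at infinity.\<close>

definition normalize_vec :: "'b \<times> real \<Rightarrow> 'b \<times> real" where
  "normalize_vec = (\<lambda>(v, t). (smul L (of_real (1 / vnorm v)) v, t / vnorm v))"

text \<open>The choice of \<open>z\<close> does not matter, as \<open>normalize_vec\<close> is constant along nonzero rays.\<close>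

definition unit_vector :: "('b \<times> real) set \<Rightarrow> 'b" where
  "unit_vector \<theta> = fst (normalize_vec (SOME z. z \<in> \<theta>))"

definition inv_norm :: "('b \<times> real) set \<Rightarrow> real" where
  "inv_norm \<theta> = snd (normalize_vec (SOME z. z \<in> \<theta>))"

lemma normalize_ray:
  assumes "v \<in> nonzero_part L"
  shows "(unit_vector (ray L v t), inv_norm (ray L v t)) = normalize_vec (v, t)"
proof -
  have v: "v \<in> total L" using assms nonzero_total by blast
  have "(SOME z. z \<in> ray L v t) \<in> ray L v t" using ray_self[OF v] by (rule someI)
  then obtain a where a: "a > 0" "(SOME z. z \<in> ray L v t) = (smul L (of_real a) v, a * t)"
    unfolding mem_ray by blast
  have "vnorm v > 0" using assms by simp
  then show ?thesis unfolding unit_vector_def inv_norm_def a(2) prod.collapse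
    using a(1) v vnorm_smul[OF v, of a] by (simp add: normalize_vec_def field_simps)
qed

lemma
  assumes "v \<in> nonzero_part L"
  shows unit_vector_ray: "unit_vector (ray L v t) = smul L (of_real (1 / vnorm v)) v"
    and inv_norm_ray: "inv_norm (ray L v t) = t / vnorm v"
  using normalize_ray[OF assms, of t] unfolding normalize_vec_def by auto

lemma vnorm_normalized:
  assumes "v \<in> nonzero_part L" shows "vnorm (smul L (of_real (1 / vnorm v)) v) = 1"
  using vnorm_smul[OF nonzero_total[OF assms], of "1 / vnorm v"] vnorm_pos[OF assms] by simp

lemma unit_ray:
  assumes "v \<in> nonzero_part L" "vnorm v = 1"
  shows "unit_vector (ray L v t) = v" "inv_norm (ray L v t) = t"
  using assms by (simp_all add: unit_vector_ray inv_norm_ray nonzero_total)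

lemma base_point_ray:
  assumes "v \<in> total L" shows "base_point L (ray L v t) = bproj L v"
  unfolding base_point_def
proof (rule the_equality)
  show "\<exists>(w, r)\<in>ray L v t. bproj L w = bproj L v" using ray_self[OF assms] by blast
  fix x assume "\<exists>(w, r)\<in>ray L v t. bproj L w = x"
  then show "x = bproj L v" using assms by (auto simp: mem_ray)
qed

lemma nonzero_raysD:
  assumes "\<theta> \<in> nonzero_rays"
  shows "unit_vector \<theta> \<in> nonzero_part L" "vnorm (unit_vector \<theta>) = 1" "inv_norm \<theta> \<ge> 0"
    "ray L (unit_vector \<theta>) (inv_norm \<theta>) = \<theta>" "bproj L (unit_vector \<theta>) = base_point L \<theta>"
proof -
  obtain v t where vt: "\<theta> = ray L v t" "v \<in> nonzero_part L" "t \<ge> 0"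
    using assms unfolding nonzero_rays_def by blast
  have v: "v \<in> total L" and n: "vnorm v > 0" using vt nonzero_total by auto
  show "unit_vector \<theta> \<in> nonzero_part L"
    unfolding vt(1) unit_vector_ray[OF vt(2)] by (rule smul_nonzero[OF vt(2)]) (use n in simp)
  show "vnorm (unit_vector \<theta>) = 1"
    unfolding vt(1) unit_vector_ray[OF vt(2)] by (rule vnorm_normalized[OF vt(2)])
  show "inv_norm \<theta> \<ge> 0" using vt n by (simp add: inv_norm_ray divide_nonneg_pos)
  show "ray L (unit_vector \<theta>) (inv_norm \<theta>) = \<theta>"
    using ray_smul[OF v, of "1 / vnorm v" t] n vt by (simp add: inv_norm_ray unit_vector_ray)
  show "bproj L (unit_vector \<theta>) = base_point L \<theta>"
    using vt v by (simp add: unit_vector_ray base_point_ray)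
qed

lemma ray_in_nonzero_rays: "v \<in> nonzero_part L \<Longrightarrow> t \<ge> 0 \<Longrightarrow> ray L v t \<in> nonzero_rays"
  unfolding nonzero_rays_def by blast

text \<open>Openness of this set, which charts express as \<open>t v \<noteq> 0\<close>, is what
  allows maps defined only on nonzero rays to descend continuously.\<close>

lemma openin_nonzero_part: "openin (bundle_topology X L) (nonzero_part L)"
proof -
  have "nonzero_part L = (\<Union>(U, t)\<in>atlas L. {v \<in> total L. bproj L v \<in> points X \<inter> U \<and> t v \<in> - {0}})"
  proof (intro set_eqI iffI)
    fix v assume v: "v \<in> nonzero_part L"
    then have "bproj L v \<in> points X" by (intro bproj_points nonzero_total)
    moreover from this obtain U t where U: "(U, t) \<in> atlas L" "bproj L v \<in> U" by (rule atlas_covers)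
    ultimately show "v \<in> (\<Union>(U, t)\<in>atlas L. {v \<in> total L. bproj L v \<in> points X \<inter> U \<and> t v \<in> - {0}})"
      using v nonzero_total[OF v] nonzero_iff_chart[OF U(1) nonzero_total[OF v] U(2)] by auto
  next
    fix v assume "v \<in> (\<Union>(U, t)\<in>atlas L. {v \<in> total L. bproj L v \<in> points X \<inter> U \<and> t v \<in> - {0}})"
    then show "v \<in> nonzero_part L" using nonzero_iff_chart by auto
  qed
  also have "openin (bundle_topology X L) \<dots>"
    using openin_topspace[of "complex_topology X"] unfolding topspace_complex_topology
    by (intro openin_Union, clarify) (rule openin_bundle_topology, auto)
  finally show ?thesis .
qed

definition nonzero_half :: "('b \<times> real) set" where
  "nonzero_half = {(v, t). v \<in> nonzero_part L \<and> t \<ge> 0}"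

lemma nonzero_half_subset: "nonzero_half \<subseteq> topspace (half_space X L)"
  unfolding nonzero_half_def using nonzero_total by (auto simp: mem_half_space)

lemma openin_nonzero_half: "openin (half_space X L) nonzero_half"
proof -
  have "openin (prod_topology (bundle_topology X L) euclideanreal) (nonzero_part L \<times> UNIV)"
    using openin_nonzero_part by (simp add: openin_prod_Times_iff)
  moreover have "nonzero_half = (nonzero_part L \<times> UNIV) \<inter> {(v, t). t \<ge> 0 \<and> (v \<in> nonzero_part L \<or> t \<noteq> 0)}"
    unfolding nonzero_half_def by auto
  ultimately show ?thesis unfolding half_space_def openin_subtopology by blast
qed

lemma nonzero_rays_image: "(\<lambda>z. ray_rel `` {z}) ` nonzero_half = nonzero_rays"
proof -
  have "(\<lambda>z. ray_rel `` {z}) ` nonzero_half = (\<lambda>(v, t). ray L v t) ` nonzero_half"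
    using nonzero_half_subset by (intro image_cong refl) auto
  then show ?thesis unfolding nonzero_rays_def nonzero_half_def by auto
qed

lemma continuous_map_normalize:
  "continuous_map (subtopology (half_space X L) nonzero_half)
     (prod_topology (bundle_topology X L) euclideanreal) normalize_vec"
proof -
  let ?Y = "subtopology (half_space X L) nonzero_half"
  have fst: "continuous_map ?Y (bundle_topology X L) fst" and snd: "continuous_map ?Y euclideanreal snd"
    unfolding half_space_def
    by (intro continuous_map_from_subtopology continuous_map_fst continuous_map_snd)+
  have n: "continuous_map ?Y euclideanreal (\<lambda>z. vnorm (fst z))"
    using continuous_map_compose[OF fst continuous_map_vnorm] by (simp add: o_def)
  have pos: "vnorm (fst z) \<noteq> 0" if "z \<in> topspace ?Y" for z
  proof -
    have "fst z \<in> nonzero_part L" using that by (auto simp: nonzero_half_def)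
    then show ?thesis using vnorm_pos by (metis less_irrefl)
  qed
  have "continuous_map ?Y euclideanreal (\<lambda>z. 1 / vnorm (fst z))"
    using n pos by (intro continuous_map_real_divide) auto
  then have "continuous_map ?Y euclidean (\<lambda>z. complex_of_real (1 / vnorm (fst z)))"
    unfolding continuous_map_euclidean_tendsto by (intro ballI tendsto_of_real) (rule bspec)
  then have "continuous_map ?Y (bundle_topology X L) (\<lambda>z. smul L (of_real (1 / vnorm (fst z))) (fst z))"
    by (rule continuous_map_smul[OF fst])
  moreover have "continuous_map ?Y euclideanreal (\<lambda>z. snd z / vnorm (fst z))"
    using n snd pos by (intro continuous_map_real_divide) auto
  ultimately show ?thesis
    unfolding normalize_vec_def by (simp add: continuous_map_pairwise o_def case_prod_beta)
qed

text \<open>\<open>nonzero_half\<close> is open, and it is saturated because positive multiples of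
  nonzero vectors are nonzero. Normalization is constant on rays, so it descends.\<close>

lemma continuous_map_unit_rep:
  "continuous_map (subtopology (compactified X L) nonzero_rays)
     (prod_topology (bundle_topology X L) euclideanreal) (\<lambda>\<theta>. (unit_vector \<theta>, inv_norm \<theta>))"
  unfolding compactified_def nonzero_rays_image[symmetric]
proof (rule continuous_map_from_quotient[OF equiv_ray_rel openin_nonzero_half _ continuous_map_normalize])
  show "q \<in> nonzero_half" if "p \<in> nonzero_half" "(p, q) \<in> ray_rel" for p q
    using that by (auto simp: nonzero_half_def mem_ray)
  show "(unit_vector (ray_rel `` {p}), inv_norm (ray_rel `` {p})) = normalize_vec p"
    if "p \<in> nonzero_half" for p
  proof -
    obtain v t where p: "p = (v, t)" by (cases p)
    then have "v \<in> nonzero_part L" "(v, t) \<in> topspace (half_space X L)"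
      using that nonzero_half_subset by (auto simp: nonzero_half_def)
    then show ?thesis using p normalize_ray ray_rel_class by simp
  qed
qed

lemma
  assumes "continuous_map Y (compactified X L) \<theta>" "\<And>y. y \<in> topspace Y \<Longrightarrow> \<theta> y \<in> nonzero_rays"
  shows continuous_map_unit_vector: "continuous_map Y (bundle_topology X L) (\<lambda>y. unit_vector (\<theta> y))"
    and continuous_map_inv_norm: "continuous_map Y euclideanreal (\<lambda>y. inv_norm (\<theta> y))"
proof -
  have "continuous_map Y (subtopology (compactified X L) nonzero_rays) \<theta>"
    using assms by (auto simp: continuous_map_in_subtopology)
  from continuous_map_compose[OF this continuous_map_unit_rep]
  show "continuous_map Y (bundle_topology X L) (\<lambda>y. unit_vector (\<theta> y))"
    "continuous_map Y euclideanreal (\<lambda>y. inv_norm (\<theta> y))"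
    by (simp_all add: continuous_map_pairwise o_def)
qed

text \<open>The counterpart of the two preceding facts: the ray depends continuously on its polar
  coordinates, because the compactification is a quotient of the half space.\<close>

lemma continuous_map_into_compactified:
  assumes "continuous_map Y (bundle_topology X L) v" "continuous_map Y euclideanreal t"
    and "\<And>y. y \<in> topspace Y \<Longrightarrow> v y \<in> nonzero_part L \<and> t y \<ge> 0"
  shows "continuous_map Y (compactified X L) (\<lambda>y. ray L (v y) (t y))"
proof -
  have "continuous_map Y (half_space X L) (\<lambda>y. (v y, t y))"
    unfolding half_space_def using assms
    by (auto simp: continuous_map_in_subtopology continuous_map_pairwise o_def)
  from continuous_map_compose[OF this continuous_map_ray] show ?thesis by (simp add: o_def)
qed

section \<open>The action, the complete space and the blowing-up in polar coordinates\<close>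

lemma circle_bundle_ray:
  assumes "v \<in> nonzero_part L" shows "ray L v t \<in> circle_bundle L \<longleftrightarrow> t = 0"
proof
  assume "ray L v t \<in> circle_bundle L"
  then obtain w where "ray L v t = ray L w 0" unfolding circle_bundle_def by blast
  then have "(v, t) \<in> ray L w 0" using ray_self[OF nonzero_total[OF assms]] by metis
  then show "t = 0" by (auto simp: mem_ray)
qed (use assms in \<open>auto simp: circle_bundle_def\<close>)

text \<open>Rescaling the representative gives \<open>[(l v, t)] = [(v, t / l)]\<close>. For
  \<open>t = 0\<close> the right-hand side is the ray itself, so the two cases of
  \<open>scale_component\<close> merge into one formula.\<close>

lemma scale_component_ray:
  assumes v: "v \<in> nonzero_part L" and l: "l > 0"
  shows "scale_component L l (ray L v t) = ray L v (t / l)"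
proof (cases "t = 0")
  case True
  then show ?thesis using circle_bundle_ray[OF v] by (simp add: scale_component_def)
next
  case False
  have v': "v \<in> total L" using v nonzero_total by blast
  have "(\<lambda>(v, t). (smul L (of_real l) v, t)) ` ray L v t
      = {(smul L (of_real l) (smul L (of_real a) v), a * t) | a. a > 0}"
    unfolding ray_def by force
  also have "\<dots> = ray L (smul L (of_real l) v) t"
    unfolding ray_def using v' by (simp add: mult.commute)
  also have "\<dots> = ray L v (t / l)" using ray_smul[OF v' l, of "t / l"] l by simp
  finally show ?thesis using False circle_bundle_ray[OF v] by (simp add: scale_component_def)
qed

text \<open>Points at infinity and finite points need no separate clauses: over \<open>D\<close>
  every nonzero ray is allowed, and off \<open>D\<close> the equation with the ray of the section
  already forces the point to infinity.\<close>

lemma cpl_points_iff: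
  "\<theta> \<in> cpl_points L D s \<longleftrightarrow> \<theta> \<in> nonzero_rays \<and>
     (base_point L \<theta> \<notin> D \<longrightarrow> \<theta> = ray L (s (base_point L \<theta>)) 0)"
proof
  assume "\<theta> \<in> cpl_points L D s"
  then show "\<theta> \<in> nonzero_rays \<and> (base_point L \<theta> \<notin> D \<longrightarrow> \<theta> = ray L (s (base_point L \<theta>)) 0)"
    unfolding cpl_points_def top_points_def circle_bundle_def
    by (auto simp: ray_in_nonzero_rays base_point_ray nonzero_total)
next
  assume A: "\<theta> \<in> nonzero_rays \<and> (base_point L \<theta> \<notin> D \<longrightarrow> \<theta> = ray L (s (base_point L \<theta>)) 0)"
  note B = nonzero_raysD[OF A[THEN conjunct1]]
  show "\<theta> \<in> cpl_points L D s"
  proof (cases "inv_norm \<theta> = 0")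
    case True
    then have "\<theta> \<in> circle_bundle L" using B circle_bundle_ray by metis
    then show ?thesis using A unfolding cpl_points_def top_points_def by simp
  next
    case False
    have "base_point L \<theta> \<in> D"
    proof (rule ccontr)
      assume "base_point L \<theta> \<notin> D"
      then have "\<theta> = ray L (s (base_point L \<theta>)) 0" using A by blast
      \<comment> \<open>A ray at infinity contains only pairs with second component 0.\<close>
      then have "(unit_vector \<theta>, inv_norm \<theta>) \<in> ray L (s (base_point L \<theta>)) 0"
        using ray_self[OF nonzero_total[OF B(1)]] B(4) by metis
      then show False using False by (auto simp: mem_ray)
    qed
    \<comment> \<open>Division by \<open>inv_norm \<theta>\<close> brings the second component to 1,
      the form in which \<open>cpl_points\<close> lists finite points.\<close>
    moreover have "\<theta> = ray L (smul L (of_real (1 / inv_norm \<theta>)) (unit_vector \<theta>)) 1"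
      using ray_smul[OF nonzero_total[OF B(1)], of "1 / inv_norm \<theta>" "inv_norm \<theta>"] B(3,4) False by simp
    ultimately show ?thesis
      unfolding cpl_points_def using B False nonzero_total[OF B(1)]
      by (intro UnI2 CollectI exI[of _ "smul L (of_real (1 / inv_norm \<theta>)) (unit_vector \<theta>)"]) simp
  qed
qed

lemma top_points_iff: "\<theta> \<in> top_points L D s \<longleftrightarrow> \<theta> \<in> cpl_points L D s \<and> inv_norm \<theta> = 0"
proof -
  have "\<theta> \<in> circle_bundle L \<longleftrightarrow> \<theta> \<in> nonzero_rays \<and> inv_norm \<theta> = 0"
  proof
    assume "\<theta> \<in> circle_bundle L"
    then show "\<theta> \<in> nonzero_rays \<and> inv_norm \<theta> = 0"
      unfolding circle_bundle_def using ray_in_nonzero_rays by (auto simp: inv_norm_ray)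
  next
    assume "\<theta> \<in> nonzero_rays \<and> inv_norm \<theta> = 0"
    then show "\<theta> \<in> circle_bundle L" using nonzero_raysD circle_bundle_ray by metis
  qed
  then show ?thesis unfolding cpl_points_iff top_points_def by blast
qed

lemma direction_ray: "direction (ray L v t) = {smul L (of_real a) v | a. a > 0}"
  unfolding direction_def ray_def by force

lemma topspace_compactified_nonzero: "nonzero_rays \<subseteq> topspace (compactified X L)"
proof -
  have "nonzero_rays = (\<lambda>(v, t). ray L v t) ` nonzero_half"
    unfolding nonzero_rays_def nonzero_half_def by auto
  also have "\<dots> \<subseteq> (\<lambda>(v, t). ray L v t) ` topspace (half_space X L)"
    using nonzero_half_subset by (rule image_mono)
  also have "\<dots> \<subseteq> topspace (compactified X L)"
    using continuous_map_ray by (rule continuous_map_image_subset_topspace)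
  finally show ?thesis .
qed

section \<open>Frames dual to fibre coordinates\<close>

definition unit_section :: "('b \<Rightarrow> complex) \<Rightarrow> 'a \<Rightarrow> 'b" where
  "unit_section t y = inv_into (fibre L y) t 1"

lemma unit_section:
  assumes "(U, t) \<in> atlas L" "y \<in> U"
  shows "unit_section t y \<in> fibre L y" and "t (unit_section t y) = 1"
proof -
  have "1 \<in> t ` fibre L y" using atlasD(3)[OF assms] by (simp add: bij_betw_def)
  then show "unit_section t y \<in> fibre L y" "t (unit_section t y) = 1"
    unfolding unit_section_def by (rule inv_into_into, rule f_inv_into_f)
qed

lemma smul_unit_section:
  assumes "(U, t) \<in> atlas L" "y \<in> U" "v \<in> fibre L y"
  shows "smul L (t v) (unit_section t y) = v"
proof -
  have "t (smul L (t v) (unit_section t y)) = t v"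
    using unit_section[OF assms(1,2)] assms atlasD(4)[OF assms(1)] by (simp add: fibre_def)
  then show ?thesis
    using unit_section[OF assms(1,2)] assms chart_inject[OF assms(1)] by (simp add: fibre_def)
qed

text \<open>The frame has coordinate 1 in its own chart, so its coordinate in another chart is the
  transition function \<open>g\<close>.\<close>

lemma regular_unit_section:
  assumes U: "(U, t) \<in> atlas L" and V: "openin (zariski X) V" "V \<subseteq> U"
  shows "regular_section X L V (unit_section t)"
  unfolding regular_section_def
proof (intro conjI ballI, goal_cases)
  case (1 y) then show ?case using unit_section(1)[OF U] V by blast
next
  case (2 c)
  obtain U' t' where c: "c = (U', t')" by (cases c)
  with 2 have U': "(U', t') \<in> atlas L" by simp
  obtain g where g: "g \<in> reg X (U \<inter> U')" "\<forall>x\<in>U \<inter> U'. g x \<noteq> 0 \<and> (\<forall>v\<in>fibre L x. t' v = g x * t v)"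
    using atlasD(5)[OF U U'] by blast
  have op: "openin (zariski X) (U \<inter> U')" "openin (zariski X) (V \<inter> U')"
    using atlasD(1)[OF U] atlasD(1)[OF U'] V by auto
  have "g \<in> reg X (V \<inter> U')" by (rule reg_mono[OF sheaf op(1) g(1) op(2)]) (use V in blast)
  then have "(\<lambda>x. t' (unit_section t x)) \<in> reg X (V \<inter> U')"
  proof (rule reg_cong[OF sheaf op(2)])
    fix x assume "x \<in> V \<inter> U'"
    then have x: "x \<in> U" "x \<in> U \<inter> U'" using V by auto
    then show "t' (unit_section t x) = g x" using g(2) unit_section[OF U x(1)] by simp
  qed
  then show ?case using c by simp
qed

lemma smul_fibre: "v \<in> fibre L x \<Longrightarrow> smul L c v \<in> fibre L x"
  by (simp add: fibre_def)

end


section \<open>The complete space and its quotient\<close>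

text \<open>Linearity concerns one slot with the others fixed, so the scalars are pulled out slot by
  slot: the induction runs over the set \<open>P\<close> of slots already scaled, and
  \<open>?m P\<close> is the family at that stage.\<close>

lemma tensor_form_smul:
  assumes T: "tensor_form I N L x \<phi>" and fin: "finite I"
    and m: "\<And>i k. i \<in> I \<Longrightarrow> k < N i \<Longrightarrow> m i k \<in> fibre (L i) x"
    and smul: "\<And>i c v. i \<in> I \<Longrightarrow> v \<in> fibre (L i) x \<Longrightarrow> smul (L i) c v \<in> fibre (L i) x"
  shows "\<phi> (\<lambda>i k. smul (L i) (a i k) (m i k)) = (\<Prod>i\<in>I. \<Prod>k<N i. a i k) * \<phi> m"
proof -
  let ?S = "Sigma I (\<lambda>i. {..<N i})"
  let ?m = "\<lambda>P i k. if (i, k) \<in> P then smul (L i) (a i k) (m i k) else m i k"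
  have T1: "\<forall>m m'. (\<forall>i\<in>I. \<forall>k<N i. m i k = m' i k) \<longrightarrow> \<phi> m = \<phi> m'"
    using T unfolding tensor_form_def by (elim conjE)
  have "\<forall>m. (\<forall>i\<in>I. \<forall>k<N i. m i k \<in> fibre (L i) x) \<longrightarrow>
        (\<forall>i\<in>I. \<forall>k<N i.
           (\<forall>c. \<phi> (m(i := (m i)(k := smul (L i) c (m i k)))) = c * \<phi> m) \<and>
           (\<forall>v\<in>fibre (L i) x.
              \<phi> (m(i := (m i)(k := vadd (L i) (m i k) v))) = \<phi> m + \<phi> (m(i := (m i)(k := v)))))"
    using T unfolding tensor_form_def by (elim conjE)
  then have T2: "\<phi> (m(i := (m i)(k := smul (L i) c (m i k)))) = c * \<phi> m"
    if "\<forall>i\<in>I. \<forall>k<N i. m i k \<in> fibre (L i) x" "i \<in> I" "k < N i" for m i k c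
    using that by blast
  have "\<phi> (?m P) = (\<Prod>(i, k)\<in>P. a i k) * \<phi> m" if "finite P" "P \<subseteq> ?S" for P
    using that
  proof (induction P rule: finite_induct)
    case (insert z P)
    obtain i k where z: "z = (i, k)" by (cases z)
    then have ik: "i \<in> I" "k < N i" "(i, k) \<notin> P" using insert by auto
    have "?m (insert z P) = (?m P)(i := (?m P i)(k := smul (L i) (a i k) (?m P i k)))"
      using ik z by (auto simp: fun_eq_iff)
    then have "\<phi> (?m (insert z P)) = a i k * \<phi> (?m P)"
      using T2[of "?m P" i k "a i k"] m smul ik by simp
    then show ?case using insert z by (simp add: mult.assoc)
  qed simp
  from this[of ?S] have "\<phi> (?m ?S) = (\<Prod>(i, k)\<in>?S. a i k) * \<phi> m" using fin by simp
  moreover have "\<phi> (?m ?S) = \<phi> (\<lambda>i k. smul (L i) (a i k) (m i k))"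
    using T1[rule_format, of "?m ?S" "\<lambda>i k. smul (L i) (a i k) (m i k)"] by simp
  ultimately show ?thesis using fin by (simp add: prod.Sigma)
qed

locale snc_line_bundles = function_space X
  for X :: "'a fun_space" +
  fixes I :: "'i set" and D :: "'i \<Rightarrow> 'a set" and N :: "'i \<Rightarrow> nat"
    and L :: "'i \<Rightarrow> ('a, 'b) line_bundle" and H :: "'i \<Rightarrow> 'b \<Rightarrow> 'b \<Rightarrow> complex"
    and s :: "'i \<Rightarrow> 'a \<Rightarrow> 'b" and u :: "'a \<Rightarrow> ('i \<Rightarrow> nat \<Rightarrow> 'b) \<Rightarrow> complex"
  assumes finite_I: "finite I"
    and bundles: "\<And>i. i \<in> I \<Longrightarrow> hermitian_line_bundle X (L i) (H i)"
    and sections: "\<And>i. i \<in> I \<Longrightarrow> regular_section X (L i) (points X) (s i)"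
    and zeros: "\<And>i. i \<in> I \<Longrightarrow> zero_locus X (L i) (s i) = D i"
    and tensor: "regular_tensor_section X I N L u"
    and nonvanishing: "nowhere_vanishing X I N L u"
begin

lemma tensor_form_u: "x \<in> points X \<Longrightarrow> tensor_form I N L x (u x)"
  using tensor unfolding regular_tensor_section_def by simp

lemma u_smul:
  assumes "x \<in> points X" "\<And>i k. i \<in> I \<Longrightarrow> k < N i \<Longrightarrow> m i k \<in> fibre (L i) x"
  shows "u x (\<lambda>i k. smul (L i) (a i k) (m i k)) = (\<Prod>i\<in>I. \<Prod>k<N i. a i k) * u x m"
  by (rule tensor_form_smul[OF tensor_form_u[OF assms(1)] finite_I assms(2)])
    (auto intro: hermitian_line_bundle.smul_fibre[OF bundles])

lemma u_cong:
  assumes "x \<in> points X" "\<And>i k. i \<in> I \<Longrightarrow> k < N i \<Longrightarrow> m i k = m' i k"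
  shows "u x m = u x m'"
proof -
  have "\<forall>m m'. (\<forall>i\<in>I. \<forall>k<N i. m i k = m' i k) \<longrightarrow> u x m = u x m'"
    using tensor_form_u[OF assms(1)] unfolding tensor_form_def by (elim conjE)
  then show ?thesis using assms(2) by blast
qed

text \<open>The local expression of \<open>u\<close>: all bundles are trivialized over one open set,
  and \<open>c\<close> is the coefficient of \<open>u\<close> with respect to the product of the
  fibre coordinates.\<close>

definition local_frame :: "'a set \<Rightarrow> ('a \<Rightarrow> complex) \<Rightarrow> ('i \<Rightarrow> 'b \<Rightarrow> complex) \<Rightarrow> bool" where
  "local_frame V c \<tau> \<longleftrightarrow> openin (zariski X) V \<and> c \<in> reg X V \<and> (\<forall>y\<in>V. c y \<noteq> 0) \<and>
     (\<forall>i\<in>I. \<exists>U. (U, \<tau> i) \<in> atlas (L i) \<and> V \<subseteq> U) \<and>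
     (\<forall>y\<in>V. \<forall>v. (\<forall>i\<in>I. v i \<in> fibre (L i) y) \<longrightarrow>
        contract_powers u y v = c y * (\<Prod>i\<in>I. \<tau> i (v i) ^ N i))"

text \<open>Finitely many charts have an open intersection. The coefficient \<open>c\<close> is
  \<open>u\<close> contracted with regular frames, hence regular; a zero of \<open>c\<close> at
  \<open>y\<close> would make \<open>u y\<close> vanish on all families of vectors over
  \<open>y\<close>.\<close>

lemma local_frame_exists:
  assumes x: "x \<in> points X" obtains V c \<tau> where "local_frame V c \<tau>" "x \<in> V"
proof -
  have "\<forall>i\<in>I. \<exists>Ut. Ut \<in> atlas (L i) \<and> x \<in> fst Ut"
    using hermitian_line_bundle.atlas_covers[OF bundles x] by (metis fst_conv)
  then obtain Ut where Ut: "\<forall>i\<in>I. Ut i \<in> atlas (L i) \<and> x \<in> fst (Ut i)" by metis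
  define U \<tau> where "U = (\<lambda>i. fst (Ut i))" and "\<tau> = (\<lambda>i. snd (Ut i))"
  have at: "(U i, \<tau> i) \<in> atlas (L i)" "x \<in> U i" if "i \<in> I" for i
    using Ut that by (auto simp: U_def \<tau>_def)
  define V where "V = (\<Inter>i\<in>I. U i) \<inter> points X"
  have V: "openin (zariski X) V"
    unfolding V_def using hermitian_line_bundle.atlasD(1)[OF bundles at(1)] finite_I
    by (intro openin_INT) auto
  have VU: "V \<subseteq> U i" if "i \<in> I" for i unfolding V_def using that by auto
  have Vp: "V \<subseteq> points X" unfolding V_def by simp
  let ?e = "\<lambda>i. hermitian_line_bundle.unit_section (L i) (\<tau> i)"
  define c where "c = (\<lambda>y. u y (\<lambda>i k. ?e i y))"
  have reg_e: "regular_section X (L i) V (?e i)" if "i \<in> I" for i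
    by (rule hermitian_line_bundle.regular_unit_section[OF bundles[OF that] at(1)[OF that] V VU[OF that]])
  have "\<forall>W \<sigma>. openin (zariski X) W \<and> (\<forall>i\<in>I. \<forall>k<N i. regular_section X (L i) W (\<sigma> i k)) \<longrightarrow>
      (\<lambda>x. u x (\<lambda>i k. \<sigma> i k x)) \<in> reg X W"
    using tensor unfolding regular_tensor_section_def by (elim conjE)
  from this[rule_format, of V "\<lambda>i k. ?e i"] have creg: "c \<in> reg X V" unfolding c_def using V reg_e by simp
  have e: "?e i y \<in> fibre (L i) y" if "i \<in> I" "y \<in> V" for i y
    using hermitian_line_bundle.unit_section(1)[OF bundles[OF that(1)] at(1)[OF that(1)]] VU that by blast
  \<comment> \<open>Stated for vectors that may vary with the slot \<open>k\<close>, and not for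
    powers alone, because the nonvanishing of \<open>u\<close> is witnessed by such a
    family.\<close>
  have expand: "u y m = (\<Prod>i\<in>I. \<Prod>k<N i. \<tau> i (m i k)) * c y"
    if y: "y \<in> V" and m: "\<And>i k. i \<in> I \<Longrightarrow> k < N i \<Longrightarrow> m i k \<in> fibre (L i) y" for y m
  proof -
    have "u y m = u y (\<lambda>i k. smul (L i) (\<tau> i (m i k)) (?e i y))"
    proof (rule u_cong)
      show "y \<in> points X" using y Vp by blast
      fix i k assume ik: "i \<in> I" "k < N i"
      show "m i k = smul (L i) (\<tau> i (m i k)) (?e i y)"
        using hermitian_line_bundle.smul_unit_section[OF bundles[OF ik(1)] at(1)[OF ik(1)], of y "m i k"]
          VU[OF ik(1)] m[OF ik] y by auto
    qed
    also have "\<dots> = (\<Prod>i\<in>I. \<Prod>k<N i. \<tau> i (m i k)) * c y"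
      unfolding c_def by (rule u_smul) (use y Vp e in auto)
    finally show ?thesis .
  qed
  have cnz: "c y \<noteq> 0" if y: "y \<in> V" for y
  proof -
    obtain m where "\<forall>i\<in>I. \<forall>k<N i. m i k \<in> fibre (L i) y" "u y m \<noteq> 0"
      using nonvanishing y Vp unfolding nowhere_vanishing_def by blast
    then show ?thesis using expand[OF y, of m] by auto
  qed
  have "local_frame V c \<tau>"
    unfolding local_frame_def
  proof (intro conjI ballI allI impI V creg cnz)
    show "\<exists>U. (U, \<tau> i) \<in> atlas (L i) \<and> V \<subseteq> U" if "i \<in> I" for i using at VU that by blast
    show "contract_powers u y v = c y * (\<Prod>i\<in>I. \<tau> i (v i) ^ N i)"
      if "y \<in> V" "\<forall>i\<in>I. v i \<in> fibre (L i) y" for y v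
      using expand[OF that(1), of "\<lambda>i k. v i"] that(2) by (simp add: contract_powers_def mult.commute)
  qed
  moreover have "x \<in> V" unfolding V_def using at x by auto
  ultimately show ?thesis by (rule that)
qed

section \<open>Polar coordinates on the complete space\<close>

abbreviation cpl :: "('a \<times> ('i \<Rightarrow> ('b \<times> real) set)) topology" where
  "cpl \<equiv> cpl_space X I D L s"

abbreviation vec :: "'i \<Rightarrow> ('b \<times> real) set \<Rightarrow> 'b" where
  "vec i \<equiv> hermitian_line_bundle.unit_vector (L i) (H i)"

abbreviation rho :: "'i \<Rightarrow> ('b \<times> real) set \<Rightarrow> real" where
  "rho i \<equiv> hermitian_line_bundle.inv_norm (L i) (H i)"

lemma cpl_points_rays:
  assumes "i \<in> I" "\<theta> \<in> cpl_points (L i) (D i) (s i)"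
  shows "\<theta> \<in> hermitian_line_bundle.nonzero_rays (L i)"
  using hermitian_line_bundle.cpl_points_iff[OF bundles[OF assms(1)]] assms(2) by blast

lemma topspace_cpl:
  "(x, p) \<in> topspace cpl \<longleftrightarrow> x \<in> points X \<and> p \<in> extensional I \<and>
     (\<forall>i\<in>I. p i \<in> cpl_points (L i) (D i) (s i) \<and> base_point (L i) (p i) = x)"
proof -
  have "cpl_points (L i) (D i) (s i) \<subseteq> topspace (compactified X (L i))" if "i \<in> I" for i
    using cpl_points_rays[OF that] hermitian_line_bundle.topspace_compactified_nonzero[OF bundles[OF that]]
    by blast
  then show ?thesis
    unfolding cpl_space_def by (subst topspace_fibre_product) (auto dest: subsetD)
qed

lemma topspace_top:
  "(x, p) \<in> topspace (top_space X I D L s) \<longleftrightarrow> (x, p) \<in> topspace cpl \<and> (\<forall>i\<in>I. rho i (p i) = 0)"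
proof -
  note iff = hermitian_line_bundle.top_points_iff[OF bundles]
  have "top_points (L i) (D i) (s i) \<subseteq> topspace (compactified X (L i))" if "i \<in> I" for i
    using iff[OF that] cpl_points_rays[OF that]
      hermitian_line_bundle.topspace_compactified_nonzero[OF bundles[OF that]] by blast
  then show ?thesis
    unfolding top_space_def topspace_cpl
    by (subst topspace_fibre_product) (auto dest: subsetD simp: iff)
qed

lemma cpl_component:
  assumes "(x, p) \<in> topspace cpl" "i \<in> I"
  shows "p i \<in> hermitian_line_bundle.nonzero_rays (L i)"
    and "vec i (p i) \<in> nonzero_part (L i)" and "hermitian_line_bundle.vnorm (H i) (vec i (p i)) = 1"
    and "rho i (p i) \<ge> 0" and "ray (L i) (vec i (p i)) (rho i (p i)) = p i"
    and "vec i (p i) \<in> fibre (L i) x"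
    and "x \<notin> D i \<Longrightarrow> p i = ray (L i) (s i x) 0"
proof -
  note b = bundles[OF assms(2)]
  have p: "p i \<in> cpl_points (L i) (D i) (s i)" "base_point (L i) (p i) = x"
    using assms by (auto simp: topspace_cpl)
  then show "p i \<in> hermitian_line_bundle.nonzero_rays (L i)" using cpl_points_rays assms(2) by blast
  note n = hermitian_line_bundle.nonzero_raysD[OF b this]
  show "vec i (p i) \<in> nonzero_part (L i)" "hermitian_line_bundle.vnorm (H i) (vec i (p i)) = 1"
    "rho i (p i) \<ge> 0" "ray (L i) (vec i (p i)) (rho i (p i)) = p i" by (fact n)+
  show "vec i (p i) \<in> fibre (L i) x"
    using n(1,5) p(2) hermitian_line_bundle.nonzero_total[OF b] by (simp add: fibre_def)
  show "x \<notin> D i \<Longrightarrow> p i = ray (L i) (s i x) 0"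
    using p hermitian_line_bundle.cpl_points_iff[OF b] by blast
qed

lemma continuous_map_cpl_component:
  assumes "i \<in> I"
  shows "continuous_map cpl (bundle_topology X (L i)) (\<lambda>q. vec i (snd q i))"
    and "continuous_map cpl euclideanreal (\<lambda>q. rho i (snd q i))"
proof -
  have c: "continuous_map cpl (compactified X (L i)) (\<lambda>q. snd q i)"
    using continuous_map_fibre_product_component[OF assms, of "complex_topology X"
        "\<lambda>i. subtopology (compactified X (L i)) (cpl_points (L i) (D i) (s i))"]
    unfolding cpl_space_def by (simp add: continuous_map_in_subtopology)
  have r: "snd q i \<in> hermitian_line_bundle.nonzero_rays (L i)" if "q \<in> topspace cpl" for q
    using cpl_component(1)[of "fst q" "snd q" i] that assms by simp
  show "continuous_map cpl (bundle_topology X (L i)) (\<lambda>q. vec i (snd q i))"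
    by (rule hermitian_line_bundle.continuous_map_unit_vector[OF bundles[OF assms] c r])
  show "continuous_map cpl euclideanreal (\<lambda>q. rho i (snd q i))"
    by (rule hermitian_line_bundle.continuous_map_inv_norm[OF bundles[OF assms] c r])
qed

lemma continuous_map_cpl_base: "continuous_map cpl (complex_topology X) fst"
  unfolding cpl_space_def by (rule continuous_map_fibre_product_base)

section \<open>The sign of f in a local frame and its continuity\<close>

lemma contract_powers_frame:
  assumes fr: "local_frame V c \<tau>" and V: "y \<in> V" and v: "\<And>i. i \<in> I \<Longrightarrow> v i \<in> fibre (L i) y"
  shows "contract_powers u y v = c y * (\<Prod>i\<in>I. \<tau> i (v i) ^ N i)"
  using assms unfolding local_frame_def by blast

lemma frame_smul:
  assumes "local_frame V c \<tau>" "y \<in> V" "i \<in> I" "v \<in> fibre (L i) y"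
  shows "\<tau> i (smul (L i) a v) = a * \<tau> i v"
proof -
  obtain U where "(U, \<tau> i) \<in> atlas (L i)" "V \<subseteq> U"
    using assms(1,3) unfolding local_frame_def by blast
  then show ?thesis
    using hermitian_line_bundle.atlasD(4)[OF bundles[OF assms(3)]] assms(2,4)
    by (auto simp: fibre_def)
qed

lemma frame_nonzero:
  assumes "local_frame V c \<tau>" "y \<in> V" "i \<in> I" "v \<in> fibre (L i) y" "v \<in> nonzero_part (L i)"
  shows "\<tau> i v \<noteq> 0"
proof -
  obtain U where "(U, \<tau> i) \<in> atlas (L i)" "V \<subseteq> U"
    using assms(1,3) unfolding local_frame_def by blast
  then show ?thesis
    using hermitian_line_bundle.nonzero_iff_chart[OF bundles[OF assms(3)]] assms(2,4,5)
    by (auto simp: fibre_def)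
qed

text \<open>Each admissible vector is a positive multiple of the unit vector of its component, and
  \<open>sgn\<close> discards the resulting positive factors \<open>a i ^ N i\<close>. The value is
  thus well defined, and the set of divisors through \<open>x\<close> has disappeared from the
  formula.\<close>

lemma sign_f_frame:
  assumes fr: "local_frame V c \<tau>" and x: "x \<in> V" and p: "(x, p) \<in> topspace cpl"
  shows "sign_f I D s u (x, p) = sgn (c x * (\<Prod>i\<in>I. \<tau> i (vec i (p i)) ^ N i))"
proof -
  let ?J = "indices_at I D x" and ?z = "c x * (\<Prod>i\<in>I. \<tau> i (vec i (p i)) ^ N i)"
  let ?w = "\<lambda>v. contract_powers u x (\<lambda>i. if i \<in> ?J then v i else s i x)"
  have x': "x \<in> points X" using p by (simp add: topspace_cpl)
  have dir: "direction (p i) = {smul (L i) (of_real a) (vec i (p i)) | a. a > 0}" if "i \<in> I" for i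
    using hermitian_line_bundle.direction_ray[OF bundles[OF that], of "vec i (p i)" "rho i (p i)"]
    unfolding cpl_component(5)[OF p that] .
  have w: "?w v / of_real (cmod (?w v)) = sgn ?z" if v: "\<forall>j\<in>?J. v j \<in> direction (p j)" for v
  proof -
    define v' where "v' = (\<lambda>i. if i \<in> ?J then v i else s i x)"
    have "\<exists>a>0. v' i = smul (L i) (of_real a) (vec i (p i))" if i: "i \<in> I" for i
    proof -
      \<comment> \<open>Where \<open>x \<notin> D i\<close> the slot holds \<open>s i x\<close>, and
        the component of the point is the ray at infinity of \<open>s i x\<close>; so the recorded
        direction is respected in this case too.\<close>
      have "v' i \<in> direction (p i)"
      proof (cases "x \<in> D i")
        case True
        then show ?thesis using v i by (simp add: v'_def indices_at_def)
      next
        case False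
        have "s i x \<in> fibre (L i) x" using sections[OF i] x' unfolding regular_section_def by blast
        then have "(s i x, 0) \<in> ray (L i) (s i x) 0"
          by (intro hermitian_line_bundle.ray_self[OF bundles[OF i]]) (simp add: fibre_def)
        then have "s i x \<in> direction (p i)"
          unfolding direction_def cpl_component(7)[OF p i False] by force
        then show ?thesis using False by (simp add: v'_def indices_at_def)
      qed
      then show ?thesis using dir[OF i] by auto
    qed
    then obtain a where a: "a i > 0" "v' i = smul (L i) (of_real (a i)) (vec i (p i))"
      if "i \<in> I" for i by metis
    have "contract_powers u x v' = c x * (\<Prod>i\<in>I. \<tau> i (v' i) ^ N i)"
    proof (rule contract_powers_frame[OF fr x])
      show "v' i \<in> fibre (L i) x" if "i \<in> I" for i
        using hermitian_line_bundle.smul_fibre[OF bundles[OF that] cpl_component(6)[OF p that]] a(2)[OF that]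
        by simp
    qed
    also have "(\<Prod>i\<in>I. \<tau> i (v' i) ^ N i)
        = (\<Prod>i\<in>I. of_real (a i ^ N i) * \<tau> i (vec i (p i)) ^ N i)"
      using a frame_smul[OF fr x _ cpl_component(6)[OF p]]
      by (intro prod.cong refl) (simp add: power_mult_distrib)
    also have "c x * \<dots> = of_real (\<Prod>i\<in>I. a i ^ N i) * ?z" by (simp add: prod.distrib)
    finally have "contract_powers u x v' = of_real (\<Prod>i\<in>I. a i ^ N i) * ?z" .
    moreover have "(\<Prod>i\<in>I. a i ^ N i) > 0" using a by (intro prod_pos) simp
    ultimately have "sgn (contract_powers u x v') = sgn ?z" by (simp only: sgn_mult sgn_of_real) simp
    then show ?thesis unfolding v'_def by (simp add: sgn_eq)
  qed
  \<comment> \<open>Some admissible family must exist, as otherwise every number would satisfy the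
    description and \<open>THE\<close> would not determine a value.\<close>
  have ex: "\<forall>j\<in>?J. vec j (p j) \<in> direction (p j)"
  proof
    fix j assume "j \<in> ?J"
    then have j: "j \<in> I" by (simp add: indices_at_def)
    have "smul (L j) 1 (vec j (p j)) = vec j (p j)"
      using hermitian_line_bundle.smul_one[OF bundles[OF j]] cpl_component(6)[OF p j] by (simp add: fibre_def)
    then show "vec j (p j) \<in> direction (p j)"
      unfolding dir[OF j] by (intro CollectI exI[of _ "1::real"]) simp
  qed
  show ?thesis
    unfolding sign_f_def split Let_def
  proof (rule the_equality)
    show "\<forall>v. (\<forall>j\<in>?J. v j \<in> direction (p j)) \<longrightarrow> sgn ?z = ?w v / of_real (cmod (?w v))"
      by (intro allI impI) (rule w[symmetric])
    show "\<sigma> = sgn ?z" if "\<forall>v. (\<forall>j\<in>?J. v j \<in> direction (p j)) \<longrightarrow> \<sigma> = ?w v / of_real (cmod (?w v))" for \<sigma>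
      using that[THEN spec, THEN mp, OF ex] w[OF ex] by (rule trans)
  qed
qed

text \<open>In a frame the sign is a single expression in the regular function \<open>c\<close> and
  the coordinates of the unit vectors, so continuity across the strata of \<open>D\<close> requires
  no separate argument.\<close>

lemma continuous_map_sign_f: "continuous_map cpl (top_of_set (sphere 0 1)) (sign_f I D s u)"
proof (rule continuous_map_locally)
  fix q assume q: "q \<in> topspace cpl"
  obtain x p where xp: "q = (x, p)" by (cases q)
  then have x: "x \<in> points X" using q by (simp add: topspace_cpl)
  obtain V c \<tau> where fr: "local_frame V c \<tau>" and xV: "x \<in> V" using local_frame_exists[OF x] .
  have V: "openin (zariski X) V" "c \<in> reg X V" "\<And>y. y \<in> V \<Longrightarrow> c y \<noteq> 0"
    using fr unfolding local_frame_def by blast+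
  let ?U = "{q \<in> topspace cpl. fst q \<in> V}"
  let ?Y = "subtopology cpl ?U"
  let ?z = "\<lambda>q. c (fst q) * (\<Prod>i\<in>I. \<tau> i (vec i (snd q i)) ^ N i)"
  \<comment> \<open>\<open>sgn\<close> is continuous only away from 0.\<close>
  have nz: "?z y \<noteq> 0" if "y \<in> topspace ?Y" for y
    using that V(3) frame_nonzero[OF fr] cpl_component(2,6)[of "fst y" "snd y"] finite_I by auto
  have "continuous_map ?Y (subtopology (complex_topology X) V) fst"
    using continuous_map_cpl_base by (auto simp: continuous_map_in_subtopology continuous_map_from_subtopology)
  from continuous_map_compose[OF this continuous_map_reg[OF V(1,2)]]
  have c: "continuous_map ?Y euclidean (\<lambda>q. c (fst q))" by (simp add: o_def)
  have t: "continuous_map ?Y euclidean (\<lambda>q. \<tau> i (vec i (snd q i)))" if i: "i \<in> I" for i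
  proof -
    obtain U where U: "(U, \<tau> i) \<in> atlas (L i)" "V \<subseteq> U" using fr i unfolding local_frame_def by blast
    have "bproj (L i) (vec i (snd y i)) \<in> U" if "y \<in> topspace ?Y" for y
      using that U(2) cpl_component(6)[of "fst y" "snd y" i] i by (auto simp: fibre_def)
    then have "continuous_map ?Y (subtopology (bundle_topology X (L i)) {v. bproj (L i) v \<in> U})
        (\<lambda>q. vec i (snd q i))"
      using continuous_map_cpl_component(1)[OF i]
      by (auto simp: continuous_map_in_subtopology continuous_map_from_subtopology)
    from continuous_map_compose[OF this hermitian_line_bundle.continuous_map_chart[OF bundles[OF i] U(1)]]
    show ?thesis by (simp add: o_def)
  qed
  have "continuous_map ?Y euclidean (\<lambda>q. sgn (?z q))"
    unfolding continuous_map_euclidean_tendsto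
    by (intro ballI tendsto_sgn tendsto_mult tendsto_prod tendsto_power nz)
      (use c t in \<open>auto simp: continuous_map_euclidean_tendsto\<close>)
  then have "continuous_map ?Y (top_of_set (sphere 0 1)) (\<lambda>q. sgn (?z q))"
    using nz by (auto simp: continuous_map_in_subtopology norm_sgn)
  then have "continuous_map ?Y (top_of_set (sphere 0 1)) (sign_f I D s u)"
  proof (rule continuous_map_eq)
    fix y assume "y \<in> topspace ?Y"
    then show "sgn (?z y) = sign_f I D s u y"
      using sign_f_frame[OF fr, of "fst y" "snd y"] by simp
  qed
  moreover have "openin cpl ?U"
    using continuous_map_cpl_base openin_complex_topology[OF V(1)]
    by (rule openin_continuous_map_preimage)
  ultimately show "\<exists>U. openin cpl U \<and> q \<in> U \<and>
    continuous_map (subtopology cpl U) (top_of_set (sphere 0 1)) (sign_f I D s u)"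
    using q xp xV by (intro exI[of _ ?U]) simp
qed

section \<open>Normalization onto A'Campo's space and its section\<close>

abbreviation Q :: "('a \<times> ('i \<Rightarrow> ('b \<times> real) set)) topology" where
  "Q \<equiv> open_part X I D L s"

abbreviation acampo where
  "acampo \<equiv> acampo_space X I D L s"

definition total_rho :: "'a \<times> ('i \<Rightarrow> ('b \<times> real) set) \<Rightarrow> real" where
  "total_rho q = (\<Sum>i\<in>I. rho i (snd q i))"

text \<open>The barycentric weights are proportional to the inverse norms, so a component at
  infinity has weight 0. The second part pushes every component to infinity along its own
  direction.\<close>

definition to_acampo ::
    "'a \<times> ('i \<Rightarrow> ('b \<times> real) set) \<Rightarrow> ('a \<times> ('i \<Rightarrow> real)) \<times> ('a \<times> ('i \<Rightarrow> ('b \<times> real) set))" where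
  "to_acampo q = ((fst q, \<lambda>i\<in>I. rho i (snd q i) / total_rho q),
     (fst q, \<lambda>i\<in>I. ray (L i) (vec i (snd q i)) 0))"

text \<open>Component \<open>i\<close> becomes the vector of length \<open>1 / \<xi> i\<close> in
  its direction, or stays at infinity if \<open>\<xi> i = 0\<close>. This picks the point of an
  orbit whose inverse norms have sum 1.\<close>

definition from_acampo ::
    "('a \<times> ('i \<Rightarrow> real)) \<times> ('a \<times> ('i \<Rightarrow> ('b \<times> real) set)) \<Rightarrow> 'a \<times> ('i \<Rightarrow> ('b \<times> real) set)" where
  "from_acampo z = (fst (snd z), \<lambda>i\<in>I. ray (L i) (vec i (snd (snd z) i)) (snd (fst z) i))"

lemma unit_ray:
  assumes "(x, p) \<in> topspace cpl" "i \<in> I"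
  shows "vec i (ray (L i) (vec i (p i)) t) = vec i (p i)" "rho i (ray (L i) (vec i (p i)) t) = t"
  using hermitian_line_bundle.unit_ray[OF bundles[OF assms(2)]] cpl_component[OF assms] by metis+

text \<open>Off \<open>D i\<close> the component is the ray at infinity of \<open>s i x\<close>, a
  nonzero vector since \<open>s i\<close> vanishes only on \<open>D i\<close>.\<close>

lemma rho_off_divisor:
  assumes p: "(x, p) \<in> topspace cpl" and i: "i \<in> I" and x: "x \<notin> D i" shows "rho i (p i) = 0"
proof -
  have "x \<in> points X" using p by (simp add: topspace_cpl)
  then have "s i x \<in> nonzero_part (L i)" using zeros[OF i] x unfolding zero_locus_def by blast
  then show ?thesis
    using hermitian_line_bundle.inv_norm_ray[OF bundles[OF i]] cpl_component(7)[OF p i x] by simp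
qed

text \<open>Radial coordinates can be replaced freely as long as they are nonnegative and vanish off
  the divisors. The choice \<open>t = 0\<close> serves the projection to infinity,
  \<open>t = \<xi>\<close> the section, and \<open>rho\<close> divided by \<open>l\<close> the
  action.\<close>

lemma cpl_ray:
  assumes q: "(x, p) \<in> topspace cpl"
    and t: "\<And>i. i \<in> I \<Longrightarrow> t i \<ge> 0" "\<And>i. i \<in> I \<Longrightarrow> x \<notin> D i \<Longrightarrow> t i = 0"
  shows "(x, \<lambda>i\<in>I. ray (L i) (vec i (p i)) (t i)) \<in> topspace cpl"
  unfolding topspace_cpl
proof (intro conjI ballI)
  show "x \<in> points X" using q by (simp add: topspace_cpl)
  fix i assume i: "i \<in> I"
  note b = bundles[OF i] and c = cpl_component[OF q i]
  have v: "vec i (p i) \<in> total (L i)" "bproj (L i) (vec i (p i)) = x" using c(6) by (auto simp: fibre_def)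
  have bp: "base_point (L i) (ray (L i) (vec i (p i)) (t i)) = x"
    using hermitian_line_bundle.base_point_ray[OF b v(1)] v(2) by simp
  have "ray (L i) (vec i (p i)) (t i) = ray (L i) (s i x) 0" if "x \<notin> D i"
    using rho_off_divisor[OF q i that] c(5) c(7)[OF that] t(2)[OF i that] by simp
  then have "ray (L i) (vec i (p i)) (t i) \<in> cpl_points (L i) (D i) (s i)"
    unfolding hermitian_line_bundle.cpl_points_iff[OF b] bp
    using hermitian_line_bundle.ray_in_nonzero_rays[OF b c(2) t(1)[OF i]] by blast
  then show "(\<lambda>i\<in>I. ray (L i) (vec i (p i)) (t i)) i \<in> cpl_points (L i) (D i) (s i)" using i by simp
  show "base_point (L i) ((\<lambda>i\<in>I. ray (L i) (vec i (p i)) (t i)) i) = x" using bp i by simp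
qed simp

lemma topspace_open_part:
  "(x, p) \<in> topspace Q \<longleftrightarrow> (x, p) \<in> topspace cpl \<and> (\<exists>i\<in>I. rho i (p i) \<noteq> 0)"
  unfolding open_part_def by (auto simp: topspace_top)

lemma total_rho_pos:
  assumes "q \<in> topspace Q" shows "total_rho q > 0"
proof -
  obtain x p where q: "q = (x, p)" by (cases q)
  then obtain i where i: "i \<in> I" "rho i (p i) \<noteq> 0" and p: "(x, p) \<in> topspace cpl"
    using assms by (auto simp: topspace_open_part)
  have "rho i (p i) > 0" using cpl_component(4)[OF p i(1)] i(2) by simp
  then show ?thesis
    unfolding total_rho_def q using cpl_component(4)[OF p] i(1) finite_I by (auto intro!: sum_pos2)
qed

lemma topspace_acampo:
  "((x, \<xi>), (y, \<theta>)) \<in> topspace acampo \<longleftrightarrow> y = x \<and> x \<in> (\<Union>i\<in>I. D i) \<and> \<xi> \<in> std_simplex I \<and>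
     (\<forall>i\<in>I. x \<notin> D i \<longrightarrow> \<xi> i = 0) \<and> (x, \<theta>) \<in> topspace cpl \<and> (\<forall>i\<in>I. rho i (\<theta> i) = 0)"
  unfolding acampo_space_def divisor_with_simplices_def
  using topspace_cpl by (auto simp: topspace_top std_simplex_def PiE_iff)

lemma continuous_map_open_part: "continuous_map cpl Z g \<Longrightarrow> continuous_map Q Z g"
  unfolding open_part_def by (rule continuous_map_from_subtopology)

lemma continuous_map_direction_at_infinity:
  assumes "i \<in> I"
  shows "continuous_map cpl (compactified X (L i)) (\<lambda>q. ray (L i) (vec i (snd q i)) 0)"
  by (rule hermitian_line_bundle.continuous_map_into_compactified[OF bundles[OF assms]
        continuous_map_cpl_component(1)[OF assms]])
    (use cpl_component(2) assms in auto)

lemma to_acampo_topspace: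
  assumes q: "q \<in> topspace Q" shows "to_acampo q \<in> topspace acampo"
proof -
  obtain x p where xp: "q = (x, p)" by (cases q)
  then have p: "(x, p) \<in> topspace cpl" and ex: "\<exists>i\<in>I. rho i (p i) \<noteq> 0"
    using q by (auto simp: topspace_open_part)
  have pos: "total_rho (x, p) > 0" using total_rho_pos q xp by simp
  have "(\<Sum>i\<in>I. rho i (p i) / total_rho (x, p)) = 1"
    using pos by (simp add: sum_divide_distrib[symmetric]) (simp add: total_rho_def)
  then have "(\<lambda>i\<in>I. rho i (p i) / total_rho (x, p)) \<in> std_simplex I"
    unfolding std_simplex_def using pos cpl_component(4)[OF p] by simp
  \<comment> \<open>A nonzero inverse norm can occur only in a component with
    \<open>x \<in> D i\<close>; this is why the open part lies over the divisor.\<close>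
  moreover have "x \<in> (\<Union>i\<in>I. D i)" using ex rho_off_divisor[OF p] by blast
  ultimately show ?thesis
    unfolding to_acampo_def xp fst_conv snd_conv topspace_acampo
    using cpl_ray[OF p, of "\<lambda>_. 0"] rho_off_divisor[OF p] unit_ray[OF p] by simp
qed

lemma continuous_map_to_acampo: "continuous_map Q acampo to_acampo"
proof -
  have rho: "continuous_map Q euclideanreal (\<lambda>q. rho i (snd q i))" if "i \<in> I" for i
    using continuous_map_cpl_component(2)[OF that] by (rule continuous_map_open_part)
  have "continuous_map Q euclideanreal total_rho"
    unfolding total_rho_def by (intro continuous_map_sum finite_I rho)
  moreover have "total_rho q \<noteq> 0" if "q \<in> topspace Q" for q using total_rho_pos[OF that] by simp
  ultimately have xi: "continuous_map Q euclideanreal (\<lambda>q. rho i (snd q i) / total_rho q)"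
    if "i \<in> I" for i
    using rho[OF that] by (intro continuous_map_real_divide)
  have base: "continuous_map Q (complex_topology X) fst"
    using continuous_map_cpl_base by (rule continuous_map_open_part)
  have mem: "((fst q, \<lambda>i\<in>I. rho i (snd q i) / total_rho q), (fst q, \<lambda>i\<in>I. ray (L i) (vec i (snd q i)) 0))
      \<in> topspace acampo" if "q \<in> topspace Q" for q
    using to_acampo_topspace[OF that] unfolding to_acampo_def .
  have "continuous_map Q (divisor_with_simplices X I D)
      (\<lambda>q. (fst q, \<lambda>i\<in>I. rho i (snd q i) / total_rho q))"
    unfolding divisor_with_simplices_def using base xi mem[unfolded topspace_acampo]
    by (auto simp: continuous_map_in_subtopology continuous_map_pairwise continuous_map_componentwise o_def)
  moreover have "continuous_map Q (top_space X I D L s) (\<lambda>q. (fst q, \<lambda>i\<in>I. ray (L i) (vec i (snd q i)) 0))"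
    unfolding top_space_def
  proof (rule continuous_map_into_fibre_product; unfold fst_conv snd_conv)
    show "continuous_map Q (compactified X (L i)) (\<lambda>q. (\<lambda>i\<in>I. ray (L i) (vec i (snd q i)) 0) i)"
      if "i \<in> I" for i
      using continuous_map_open_part[OF continuous_map_direction_at_infinity[OF that]] that by simp
    show "(\<lambda>i\<in>I. ray (L i) (vec i (snd q i)) 0) i \<in> top_points (L i) (D i) (s i) \<and>
        base_point (L i) ((\<lambda>i\<in>I. ray (L i) (vec i (snd q i)) 0) i) = fst q"
      if "q \<in> topspace Q" "i \<in> I" for q i
      using mem[OF that(1)] that(2) hermitian_line_bundle.top_points_iff[OF bundles[OF that(2)]]
      unfolding topspace_acampo topspace_cpl by blast
  qed (use base in auto)
  ultimately show ?thesis
    unfolding acampo_space_def to_acampo_def using mem[unfolded topspace_acampo]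
    by (auto simp: continuous_map_in_subtopology continuous_map_pairwise o_def)
qed

text \<open>The blowing-up includes continuously into the complete space because both take their
  component topologies from the same compactified bundles; hence the argument by components.\<close>

lemma continuous_map_acampo:
  shows "continuous_map acampo cpl snd"
    and "i \<in> I \<Longrightarrow> continuous_map acampo euclideanreal (\<lambda>z. snd (fst z) i)"
proof -
  have f: "continuous_map acampo (divisor_with_simplices X I D) fst"
    and t: "continuous_map acampo (top_space X I D L s) snd"
    unfolding acampo_space_def
    by (intro continuous_map_from_subtopology continuous_map_fst)
      (auto intro!: continuous_map_from_subtopology
        continuous_map_snd[of _ "subtopology _ _", unfolded continuous_map_in_subtopology, THEN conjunct1])
  have tx: "continuous_map acampo (complex_topology X) (\<lambda>z. fst (snd z))"
    using continuous_map_compose[OF t, unfolded top_space_def, OF continuous_map_fibre_product_base]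
    by (simp add: o_def)
  show "continuous_map acampo cpl snd"
    unfolding cpl_space_def
  proof (rule continuous_map_into_fibre_product[OF tx])
    show "continuous_map acampo (compactified X (L i)) (\<lambda>z. snd (snd z) i)" if "i \<in> I" for i
      using continuous_map_compose[OF t, unfolded top_space_def, OF continuous_map_fibre_product_component[OF that]]
      by (simp add: o_def continuous_map_in_subtopology)
  qed (auto simp: topspace_acampo topspace_cpl)
  show "continuous_map acampo euclideanreal (\<lambda>z. snd (fst z) i)" if i: "i \<in> I"
  proof -
    have "continuous_map (divisor_with_simplices X I D) (product_topology (\<lambda>_. euclideanreal) I) snd"
      unfolding divisor_with_simplices_def by (intro continuous_map_from_subtopology continuous_map_snd)
    from continuous_map_compose[OF continuous_map_compose[OF f this] continuous_map_product_projection[OF i]]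
    show ?thesis by (simp add: o_def)
  qed
qed

lemma from_acampo_topspace:
  assumes "z \<in> topspace acampo" shows "from_acampo z \<in> topspace Q"
proof -
  obtain x \<xi> y \<theta> where z: "z = ((x, \<xi>), (y, \<theta>))" by (metis prod.collapse)
  have h: "y = x" "\<xi> \<in> std_simplex I" "\<forall>i\<in>I. x \<notin> D i \<longrightarrow> \<xi> i = 0" "(x, \<theta>) \<in> topspace cpl"
    using assms unfolding z topspace_acampo by blast+
  \<comment> \<open>A coordinate that is nonzero gives a finite component, which keeps the point out
    of the blowing-up.\<close>
  have "\<exists>i\<in>I. \<xi> i \<noteq> 0"
  proof (rule ccontr)
    assume "\<not> (\<exists>i\<in>I. \<xi> i \<noteq> 0)"
    then have "(\<Sum>i\<in>I. \<xi> i) = 0" by simp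
    then show False using h(2) unfolding std_simplex_def by simp
  qed
  moreover have "(x, \<lambda>i\<in>I. ray (L i) (vec i (\<theta> i)) (\<xi> i)) \<in> topspace cpl"
    by (rule cpl_ray[OF h(4)]) (use h(2,3) in \<open>auto simp: std_simplex_def\<close>)
  ultimately show ?thesis
    unfolding from_acampo_def z fst_conv snd_conv h(1) topspace_open_part
    using unit_ray[OF h(4)] by auto
qed

lemma continuous_map_from_acampo: "continuous_map acampo Q from_acampo"
proof -
  have "continuous_map acampo cpl from_acampo"
    unfolding cpl_space_def
  proof (rule continuous_map_into_fibre_product)
    show "continuous_map acampo (complex_topology X) (\<lambda>z. fst (from_acampo z))"
      using continuous_map_compose[OF continuous_map_acampo(1) continuous_map_cpl_base]
      by (simp add: o_def from_acampo_def)
    show "continuous_map acampo (compactified X (L i)) (\<lambda>z. snd (from_acampo z) i)" if i: "i \<in> I" for i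
    proof -
      have "continuous_map acampo (compactified X (L i))
          (\<lambda>z. ray (L i) (vec i (snd (snd z) i)) (snd (fst z) i))"
      proof (rule hermitian_line_bundle.continuous_map_into_compactified[OF bundles[OF i]])
        show "continuous_map acampo (bundle_topology X (L i)) (\<lambda>z. vec i (snd (snd z) i))"
          using continuous_map_compose[OF continuous_map_acampo(1) continuous_map_cpl_component(1)[OF i]]
          by (simp add: o_def)
        show "continuous_map acampo euclideanreal (\<lambda>z. snd (fst z) i)" by (rule continuous_map_acampo(2)[OF i])
        fix z assume "z \<in> topspace acampo"
        moreover obtain x \<xi> y \<theta> where "z = ((x, \<xi>), (y, \<theta>))" by (metis prod.collapse)
        ultimately show "vec i (snd (snd z) i) \<in> nonzero_part (L i) \<and> snd (fst z) i \<ge> 0"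
          using cpl_component(2)[OF _ i] i by (auto simp: topspace_acampo std_simplex_def)
      qed
      then show ?thesis using i by (simp add: from_acampo_def)
    qed
    show "snd (from_acampo z) \<in> extensional I" for z by (simp add: from_acampo_def)
    show "snd (from_acampo z) i \<in> cpl_points (L i) (D i) (s i) \<and>
        base_point (L i) (snd (from_acampo z) i) = fst (from_acampo z)"
      if "z \<in> topspace acampo" "i \<in> I" for z i
      using from_acampo_topspace[OF that(1)] that(2) topspace_open_part topspace_cpl by (metis prod.collapse)
  qed
  moreover have "from_acampo z \<in> topspace cpl - topspace (top_space X I D L s)" if "z \<in> topspace acampo" for z
    using from_acampo_topspace[OF that] unfolding open_part_def by simp
  ultimately show ?thesis
    unfolding open_part_def by (auto simp: continuous_map_in_subtopology)
qed

text \<open>The weights already have sum 1, so normalization preserves them, and a component at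
  infinity is the ray at infinity of its own unit vector.\<close>

lemma to_from_acampo:
  assumes "z \<in> topspace acampo" shows "to_acampo (from_acampo z) = z"
proof -
  obtain x \<xi> y \<theta> where z: "z = ((x, \<xi>), (y, \<theta>))" by (metis prod.collapse)
  have h: "y = x" "\<xi> \<in> std_simplex I" "(x, \<theta>) \<in> topspace cpl" "\<forall>i\<in>I. rho i (\<theta> i) = 0"
    using assms unfolding z topspace_acampo by blast+
  note r = unit_ray[OF h(3)]
  have "total_rho (from_acampo z) = (\<Sum>i\<in>I. \<xi> i)"
    unfolding total_rho_def from_acampo_def z by (intro sum.cong refl) (simp add: r)
  also have "\<dots> = 1" using h(2) by (simp add: std_simplex_def)
  finally have t: "total_rho (from_acampo z) = 1" .
  have "(\<lambda>i\<in>I. rho i (snd (from_acampo z) i) / total_rho (from_acampo z)) = \<xi>"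
    using h(2) unfolding t std_simplex_def
    by (intro ext) (auto simp: from_acampo_def z r restrict_def extensional_def)
  moreover have "(\<lambda>i\<in>I. ray (L i) (vec i (snd (from_acampo z) i)) 0) = \<theta>"
  proof (rule ext)
    fix i
    show "(\<lambda>i\<in>I. ray (L i) (vec i (snd (from_acampo z) i)) 0) i = \<theta> i"
    proof (cases "i \<in> I")
      case True
      then show ?thesis using cpl_component(5)[OF h(3) True] h(4) by (simp add: from_acampo_def z r)
    next
      case False
      then show ?thesis using h(3) by (auto simp: topspace_cpl extensional_def)
    qed
  qed
  ultimately show ?thesis unfolding to_acampo_def by (simp add: from_acampo_def z h(1))
qed

section \<open>Orbits of the diagonal action as fibres of the normalization\<close>

lemma diagonal_act_rays:
  assumes "(x, p) \<in> topspace cpl" "l > 0"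
  shows "diagonal_act I L l (x, p) = (x, \<lambda>i\<in>I. ray (L i) (vec i (p i)) (rho i (p i) / l))"
proof -
  have "scale_component (L i) l (p i) = ray (L i) (vec i (p i)) (rho i (p i) / l)" if "i \<in> I" for i
    using hermitian_line_bundle.scale_component_ray[OF bundles[OF that] cpl_component(2)[OF assms(1) that] assms(2),
        of "rho i (p i)"] cpl_component(5)[OF assms(1) that] by simp
  then show ?thesis unfolding diagonal_act_def by (simp add: restrict_def fun_eq_iff)
qed

text \<open>The action divides every \<open>rho\<close> and their sum by the same \<open>l\<close>,
  so the weights do not change; unit vectors are not moved at all.\<close>

lemma to_acampo_diagonal_act:
  assumes q: "q \<in> topspace Q" and l: "l > 0"
  shows "diagonal_act I L l q \<in> topspace Q" and "to_acampo (diagonal_act I L l q) = to_acampo q"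
proof -
  obtain x p where xp: "q = (x, p)" by (cases q)
  then have p: "(x, p) \<in> topspace cpl" and ex: "\<exists>i\<in>I. rho i (p i) \<noteq> 0"
    using q by (auto simp: topspace_open_part)
  note r = unit_ray[OF p] and act = diagonal_act_rays[OF p l]
  have "(x, \<lambda>i\<in>I. ray (L i) (vec i (p i)) (rho i (p i) / l)) \<in> topspace cpl"
    by (rule cpl_ray[OF p]) (use cpl_component(4)[OF p] rho_off_divisor[OF p] l in auto)
  then show "diagonal_act I L l q \<in> topspace Q"
    unfolding xp act topspace_open_part using ex l r by auto
  have "total_rho (diagonal_act I L l q) = (\<Sum>i\<in>I. rho i (p i) / l)"
    unfolding total_rho_def xp act by (intro sum.cong refl) (simp add: r)
  also have "\<dots> = total_rho q / l" by (simp add: total_rho_def xp sum_divide_distrib)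
  finally have t: "total_rho (diagonal_act I L l q) = total_rho q / l" .
  show "to_acampo (diagonal_act I L l q) = to_acampo q"
    unfolding to_acampo_def t using l by (auto simp: xp act r fun_eq_iff restrict_def)
qed

text \<open>The action divides \<open>total_rho\<close> by \<open>l\<close>, which leaves this
  quotient as the only candidate for \<open>l\<close>. Equal rays at infinity have equal unit
  vectors, and equal weights mean proportional inverse norms.\<close>

lemma to_acampo_eqD:
  assumes q: "q \<in> topspace Q" and q': "q' \<in> topspace Q" and eq: "to_acampo q = to_acampo q'"
  shows "q' = diagonal_act I L (total_rho q / total_rho q') q"
proof -
  obtain x p y p' where xp: "q = (x, p)" "q' = (y, p')" by (metis prod.collapse)
  then have p: "(x, p) \<in> topspace cpl" "(y, p') \<in> topspace cpl"
    using q q' by (auto simp: topspace_open_part)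
  have pos: "total_rho q > 0" "total_rho q' > 0" using total_rho_pos q q' by auto
  have xy: "y = x"
    and xi: "(\<lambda>i\<in>I. rho i (p i) / total_rho q) = (\<lambda>i\<in>I. rho i (p' i) / total_rho q')"
    and th: "(\<lambda>i\<in>I. ray (L i) (vec i (p i)) 0) = (\<lambda>i\<in>I. ray (L i) (vec i (p' i)) 0)"
    using eq unfolding to_acampo_def xp by auto
  have "p' i = ray (L i) (vec i (p i)) (rho i (p i) / (total_rho q / total_rho q'))" if i: "i \<in> I" for i
  proof -
    have "rho i (p i) / total_rho q = rho i (p' i) / total_rho q'" using fun_cong[OF xi, of i] i by simp
    then have "rho i (p' i) = rho i (p i) / (total_rho q / total_rho q')" using pos by (simp add: field_simps)
    moreover have "ray (L i) (vec i (p i)) 0 = ray (L i) (vec i (p' i)) 0" using fun_cong[OF th, of i] i by simp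
    then have "vec i (p i) = vec i (p' i)" using unit_ray(1)[OF p(1) i] unit_ray(1)[OF p(2) i] by metis
    ultimately show ?thesis using cpl_component(5)[OF p(2) i] by simp
  qed
  moreover have "p' \<in> extensional I" using p(2) by (simp add: topspace_cpl)
  ultimately have "p' = (\<lambda>i\<in>I. ray (L i) (vec i (p i)) (rho i (p i) / (total_rho q / total_rho q')))"
    by (intro extensionalityI[of _ I]) auto
  then show ?thesis
    using diagonal_act_rays[OF p(1), of "total_rho q / total_rho q'"] pos xp xy by simp
qed

text \<open>As the kernel of a map, the orbit relation is an equivalence without any verification of
  the laws of a group action.\<close>

lemma orbit_rel_eq_kernel:
  "orbit_rel X I D L s = {(q, q'). q \<in> topspace Q \<and> q' \<in> topspace Q \<and> to_acampo q = to_acampo q'}"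
proof (intro set_eqI iffI)
  fix z assume "z \<in> orbit_rel X I D L s"
  then show "z \<in> {(q, q'). q \<in> topspace Q \<and> q' \<in> topspace Q \<and> to_acampo q = to_acampo q'}"
    unfolding orbit_rel_def using to_acampo_diagonal_act by auto
next
  fix z assume "z \<in> {(q, q'). q \<in> topspace Q \<and> q' \<in> topspace Q \<and> to_acampo q = to_acampo q'}"
  then obtain q q' where z: "z = (q, q')" "q \<in> topspace Q" "q' \<in> topspace Q" "to_acampo q = to_acampo q'"
    by blast
  then have "q' = diagonal_act I L (total_rho q / total_rho q') q" "total_rho q / total_rho q' > 0"
    using to_acampo_eqD total_rho_pos by auto
  then show "z \<in> orbit_rel X I D L s" unfolding orbit_rel_def using z by blast
qed

lemma equiv_orbit_rel: "equiv (topspace Q) (orbit_rel X I D L s)"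
  unfolding orbit_rel_eq_kernel
  by (rule equivI) (auto simp: refl_on_def intro!: symI transI)

text \<open>In a frame the sign involves only unit vectors, which are kept when the components are
  pushed to infinity.\<close>

lemma acampo_map_to_acampo:
  assumes q: "q \<in> topspace Q" shows "acampo_map I D s u (to_acampo q) = sign_f I D s u q"
proof -
  obtain x p where xp: "q = (x, p)" by (cases q)
  then have p: "(x, p) \<in> topspace cpl" using q by (auto simp: topspace_open_part)
  then have "x \<in> points X" by (simp add: topspace_cpl)
  then obtain V c \<tau> where fr: "local_frame V c \<tau>" "x \<in> V" by (rule local_frame_exists)
  have "(x, \<lambda>i\<in>I. ray (L i) (vec i (p i)) 0) \<in> topspace cpl" by (rule cpl_ray[OF p]) auto
  from sign_f_frame[OF fr this] sign_f_frame[OF fr p] show ?thesis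
    unfolding acampo_map_def to_acampo_def xp by (simp add: unit_ray[OF p])
qed

text \<open>Taking \<open>sbar\<close> to be A'Campo's map transported along \<open>h\<close> makes
  the compatibility hold by construction and passes on the continuity. What remains is its value on
  classes, given by \<open>acampo_map_to_acampo\<close>.\<close>

lemma quotient_homeomorphic_acampo:
  "\<exists>sbar. continuous_map (quotient_space Q (orbit_rel X I D L s)) (top_of_set (sphere 0 1)) sbar \<and>
     (\<forall>p\<in>topspace Q. sbar (orbit_rel X I D L s `` {p}) = sign_f I D s u p) \<and>
     (\<exists>h. homeomorphic_map (quotient_space Q (orbit_rel X I D L s)) acampo h \<and>
        (\<forall>c\<in>topspace (quotient_space Q (orbit_rel X I D L s)). acampo_map I D s u (h c) = sbar c))"
proof -
  have ker: "(p, q) \<in> orbit_rel X I D L s \<longleftrightarrow> to_acampo p = to_acampo q"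
    if "p \<in> topspace Q" "q \<in> topspace Q" for p q
    unfolding orbit_rel_eq_kernel using that by simp
  obtain h where h: "homeomorphic_map (quotient_space Q (orbit_rel X I D L s)) acampo h"
    "\<And>p. p \<in> topspace Q \<Longrightarrow> h (orbit_rel X I D L s `` {p}) = to_acampo p"
    using homeomorphic_map_from_quotient[OF equiv_orbit_rel continuous_map_to_acampo
        continuous_map_from_acampo to_from_acampo ker] by blast
  have "continuous_map acampo (top_of_set (sphere 0 1)) (acampo_map I D s u)"
    unfolding acampo_map_def using continuous_map_acampo(1) continuous_map_sign_f by (rule continuous_map_compose)
  then have "continuous_map (quotient_space Q (orbit_rel X I D L s)) (top_of_set (sphere 0 1))
      (acampo_map I D s u \<circ> h)"
    using homeomorphic_imp_continuous_map[OF h(1)] by (rule continuous_map_compose[rotated])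
  then show ?thesis
    using h acampo_map_to_acampo by (intro exI[of _ "acampo_map I D s u \<circ> h"]) auto
qed

end

theorem theorem3:
  fixes X :: "'a fun_space" and f :: "'a \<Rightarrow> complex"
    and I :: "'i set" and D :: "'i \<Rightarrow> 'a set" and N :: "'i \<Rightarrow> nat"
    and L :: "'i \<Rightarrow> ('a, 'b) line_bundle" and H :: "'i \<Rightarrow> 'b \<Rightarrow> 'b \<Rightarrow> complex"
    and s :: "'i \<Rightarrow> 'a \<Rightarrow> 'b" and u :: "'a \<Rightarrow> ('i \<Rightarrow> nat \<Rightarrow> 'b) \<Rightarrow> complex"
  assumes "algebraic_variety X" and "nonsingular X"
    and "f \<in> reg X (points X)"
    and "finite I"
    and "{x \<in> points X. f x = 0} = (\<Union>i\<in>I. D i)"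
    and "\<And>i. i \<in> I \<Longrightarrow> nonsingular_hypersurface X (D i)"
    and "meet_transversally X I D"
    and "\<And>i. i \<in> I \<Longrightarrow> algebraic_line_bundle X (L i)"
    and "\<And>i. i \<in> I \<Longrightarrow> bundle_of_divisor X (D i) (L i)"
    and "\<And>i. i \<in> I \<Longrightarrow> hermitian_metric X (L i) (H i)"
    and "\<And>i. i \<in> I \<Longrightarrow> regular_section X (L i) (points X) (s i)"
    and "\<And>i. i \<in> I \<Longrightarrow> transverse_to_zero_section X (L i) (s i)"
    and "\<And>i. i \<in> I \<Longrightarrow> zero_locus X (L i) (s i) = D i"
    and "\<And>i. i \<in> I \<Longrightarrow> N i \<ge> 1"
    and "regular_tensor_section X I N L u" and "nowhere_vanishing X I N L u"
    and "\<And>x. x \<in> points X \<Longrightarrow> f x = contract_powers u x (\<lambda>i. s i x)"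
  shows "\<exists>sbar. continuous_map (quotient_space (open_part X I D L s) (orbit_rel X I D L s))
              (top_of_set (sphere 0 1)) sbar \<and>
           (\<forall>p\<in>topspace (open_part X I D L s).
              sbar (orbit_rel X I D L s `` {p}) = sign_f I D s u p) \<and>
           (\<exists>h. homeomorphic_map (quotient_space (open_part X I D L s) (orbit_rel X I D L s))
                  (acampo_space X I D L s) h \<and>
                (\<forall>c\<in>topspace (quotient_space (open_part X I D L s) (orbit_rel X I D L s)).
                   acampo_map I D s u (h c) = sbar c))"
proof -
  have fs: "function_space X"
  proof
    show "function_sheaf X" using assms(1) unfolding algebraic_variety_def by (elim conjE)
    \<comment> \<open>The function \<open>f\<close> itself is the global regular function that the
      comparison of the two topologies requires.\<close>
    show "reg X (points X) \<noteq> {}" using assms(3) by blast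
  qed
  have "snc_line_bundles X I D N L H s u"
  proof (intro snc_line_bundles.intro snc_line_bundles_axioms.intro fs)
    show "hermitian_line_bundle X (L i) (H i)" if "i \<in> I" for i
      by (intro hermitian_line_bundle.intro hermitian_line_bundle_axioms.intro fs assms that)
  qed (fact assms)+
  then show ?thesis by (rule snc_line_bundles.quotient_homeomorphic_acampo)
qed

end
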